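(* Let $M_1,M_2,M_3$ be invertible $d\times d$ matrices over $K$ representing lattices $\Lambda_1,\Lambda_2,\Lambda_3\subseteq K^d$ (the columns of $M_i$ are a basis of $\Lambda_i$). Then the convex-triangle algorithm (given step by step in the context), run on input $M_1,M_2,M_3$, correctly computes a list $L$ of apartments of $\mathcal B_d$ covering $\mathrm{conv}(\Lambda_1,\Lambda_2,\Lambda_3)$, i.e. every lattice class in $\mathrm{conv}(\Lambda_1,\Lambda_2,\Lambda_3)$ is contained in some apartment in $L$, and $L$ has size at most $2^d$.
   Context: Setting: $K$ is a field with a discrete valuation $\mathrm{val}:K\to\mathbb Z\cup\{\infty\}$, $R$ is its valuation ring and $\pi$ a uniformizer. A lattice is an $R$-submodule of $K^d$ generated by $d$ linearly independent vectors; an invertible matrix represents the lattice generated over $R$ by its columns. Lattices $\Lambda,\Lambda'$ are equivalent if $\Lambda=c\Lambda'$ for some $c\in K^*$; $[\Lambda]$ is the class of $\Lambda$. These classes are the vertices of the affine building $\mathcal B_d$ of $SL_d(K)$. For an invertible $d\times d$ matrix $A$ with columns $v_1,\dots,v_d$, the apartment $[A]$ is the set of all classes of lattices $R\{\pi^{u_1}v_1,\dots,\pi^{u_d}v_d\}$ with $u_i\in\mathbb Z$. A set of lattice classes is convex if it is closed under taking intersections of finitely many representatives. The convex hull $\mathrm{conv}(\Lambda_1,\dots,\Lambda_s)$ is the smallest convex set of lattice classes containing $[\Lambda_1],\dots,[\Lambda_s]$. SA-basis algorithm. Input: invertible $d\times d$ matrices $P,Q$ over $K$. Set $B_1=P$,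 $C_1=Q$. For $i=1,\dots,d-1$: let $N_i=B_i^{-1}C_i$; let the pivot $n_i$ be an entry of $N_i$ of minimal valuation among the entries other than the earlier pivots $n_1,\dots,n_{i-1}$ (ties are broken by choosing the leftmost column, then the topmost row); let $L_i$ be the matrix such that $L_iN_i$ is obtained from $N_i$ by eliminating (by row operations using the row of $n_i$) all other entries in the column of $n_i$; let $R_i$ be the matrix such that $L_iN_iR_i$ is obtained from $L_iN_i$ by eliminating (by column operations using the column of $n_i$) all other entries in the row of $n_i$; set $B_{i+1}=B_iL_i^{-1}$ and $C_{i+1}=C_iR_i$. Output $B_d$, called an SA-basis (simultaneously adaptable basis) for $(P,Q)$, and $N_d=B_d^{-1}C_d$, which is a monomial matrix (supported on a permutation matrix). The columns of $B_d$ and of $B_dN_d$ are bases of the lattices represented by $P$ and $Q$. With extra book-keeping the algorithm also outputs the base-change matrices $N_1,\dots,N_d$ and the positions $p_1,\dots,p_d$ of the pivots $n_1,\dots,n_d$ (the last pivot $n_d$ being the remaining nonzero entry of $N_d$). After reordering the columns (and rescaling by units), the SA-basis can be chosen so that the monomial matrix is replaced by a diagonal matrix $\mathrm{diag}(\pi^{c_1},\dots,\pi^{c_d})$ with $c_1\le\dots\le c_d$. Convex-triangle algorithm. Input: $M_1,M_2,M_3$. Output: a list $L$ of apartments. (1) Set $L=\emptyset$. (2) Let $A$ and $\Delta=\mathrm{diag}(\pi^{c_1},\dots,\pi^{c_d})$ be $d\times d$ matrices such that $A$ is a basis for $\Lambda_2$ and $A\Delta$ is a basis for $\Lambda_3$,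 with $c_1\le c_2\le\dots\le c_d$. For an integer $\lambda$ write $\Gamma_\lambda=\mathrm{diag}(\pi^{\max(\lambda,c_1)},\dots,\pi^{\max(\lambda,c_d)})$. (3) For each $i\in\{1,\dots,d-1\}$: set $\lambda\leftarrow c_i$ and $t\leftarrow 0$; then, while $\lambda<c_{i+1}$, do the following: (a) $\lambda\leftarrow\lambda+t$; (b) let $A_\lambda$ be the SA-basis for $(M_1,A\Gamma_\lambda)$, let $(N_1,\dots,N_d)$ be the sequence of base-change matrices and $(p_1,\dots,p_d)$ the sequence of pivot positions in this SA-basis computation; (c) $L\leftarrow L\cup\{[A_\lambda]\}$; (d) $t\leftarrow c_{i+1}-c_i$; (e) for each $j\in\{1,\dots,d\}$ such that $p_j$ is in the first $i$ columns: let $v_1$ be the valuation of the $j$th pivot in $N_j$, let $v_2$ be the least valuation among all entries of $N_j$ in columns $i+1,i+2,\dots,d$ not in positions $p_1,\dots,p_j$, and set $t\leftarrow\min(t,v_2-v_1+1)$. (4) Return $L$.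
   Formalization: Covering of conv(Λ1,Λ2,Λ3) is claimed only when [Λ2]≠[Λ3]; if [Λ2]=[Λ3] (always for d=1), c_1=…=c_d, no while loop is entered and the algorithm returns L=∅ although the hull contains [Λ1]. *)

theory Defs
  imports
    "Jordan_Normal_Form.Gauss_Jordan_Elimination"
    "HOL-Library.Extended"
    "HOL-Library.While_Combinator"
begin

section \<open>Discretely valued fields\<close>

text \<open>The constructor \<^const>\<open>Pinf\<close> plays the role of infinity; \<^const>\<open>Minf\<close> is never a value.
  The last axiom normalises the valuation to be surjective onto the integers.\<close>

locale discrete_valuation =
  fixes val :: "'a::field \<Rightarrow> int extended"
  assumes val_eq_Pinf: "val x = Pinf \<longleftrightarrow> x = 0"
    and val_not_Minf: "val x \<noteq> Minf"
    and val_mult: "val (x * y) = val x + val y"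
    and val_add: "min (val x) (val y) \<le> val (x + y)"
    and val_normalised: "\<exists>x. val x = Fin 1"

definition uniformizer :: "('a::field \<Rightarrow> int extended) \<Rightarrow> 'a \<Rightarrow> bool" where
  "uniformizer val \<pi> \<longleftrightarrow> val \<pi> = Fin 1"

definition valuation_ring :: "('a::field \<Rightarrow> int extended) \<Rightarrow> 'a set" where
  "valuation_ring val = {x. 0 \<le> val x}"


section \<open>Lattices, lattice classes and apartments\<close>

text \<open>All combinations of the columns of \<open>A\<close> with coefficients in the valuation ring.\<close>

definition col_lattice :: "('a::field \<Rightarrow> int extended) \<Rightarrow> 'a mat \<Rightarrow> 'a vec set" where
  "col_lattice val A =
     {A *\<^sub>v x | x. x \<in> carrier_vec (dim_col A) \<and> (\<forall>i<dim_col A. x $ i \<in> valuation_ring val)}"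

text \<open>A list of \<open>d\<close> linearly independent vectors is given as the columns of an invertible matrix.\<close>

definition is_lattice :: "('a::field \<Rightarrow> int extended) \<Rightarrow> nat \<Rightarrow> 'a vec set \<Rightarrow> bool" where
  "is_lattice val d \<Lambda> \<longleftrightarrow> (\<exists>A\<in>carrier_mat d d. invertible_mat A \<and> \<Lambda> = col_lattice val A)"

definition lat_class :: "'a::field vec set \<Rightarrow> 'a vec set set" where
  "lat_class \<Lambda> = {(\<lambda>v. c \<cdot>\<^sub>v v) ` \<Lambda> | c. c \<noteq> 0}"

definition building_vertices :: "('a::field \<Rightarrow> int extended) \<Rightarrow> nat \<Rightarrow> 'a vec set set set" where
  "building_vertices val d = {lat_class \<Lambda> | \<Lambda>. is_lattice val d \<Lambda>}"

definition apartment ::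
    "('a::field \<Rightarrow> int extended) \<Rightarrow> 'a \<Rightarrow> nat \<Rightarrow> 'a mat \<Rightarrow> 'a vec set set set" where
  "apartment val \<pi> d A =
     {lat_class (col_lattice val (A * mat_diag d (\<lambda>i. \<pi> powi u i))) | u :: nat \<Rightarrow> int. True}"

definition apartments ::
    "('a::field \<Rightarrow> int extended) \<Rightarrow> 'a \<Rightarrow> nat \<Rightarrow> 'a vec set set set set" where
  "apartments val \<pi> d = {apartment val \<pi> d A | A. A \<in> carrier_mat d d \<and> invertible_mat A}"

text \<open>The representatives of the classes in \<open>S\<close> are the elements of \<open>\<Union>S\<close>; one class may
  contribute several representatives to an intersection.\<close>

definition convex_classes ::
    "('a::field \<Rightarrow> int extended) \<Rightarrow> nat \<Rightarrow> 'a vec set set set \<Rightarrow> bool" where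
  "convex_classes val d S \<longleftrightarrow> S \<subseteq> building_vertices val d \<and>
     (\<forall>F. finite F \<and> F \<noteq> {} \<and> F \<subseteq> \<Union>S \<longrightarrow> lat_class (\<Inter>F) \<in> S)"

definition conv_lattices ::
    "('a::field \<Rightarrow> int extended) \<Rightarrow> nat \<Rightarrow> 'a vec set set \<Rightarrow> 'a vec set set set" where
  "conv_lattices val d X = convex_classes val d hull (lat_class ` X)"


section \<open>The SA-basis algorithm\<close>

text \<open>Rows, columns and steps are numbered from \<open>0\<close>.\<close>

definition inv_mat :: "'a::field mat \<Rightarrow> 'a mat" where
  "inv_mat A = the (mat_inverse A)"

text \<open>All (row, column) positions in column-major order, so that the first position of minimal
  valuation is the topmost one in the leftmost possible column.\<close>

definition positions :: "nat \<Rightarrow> (nat \<times> nat) list" where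
  "positions d = [(r, c). c \<leftarrow> [0..<d], r \<leftarrow> [0..<d]]"

definition min_pivot ::
    "('a::field \<Rightarrow> int extended) \<Rightarrow> nat \<Rightarrow> 'a mat \<Rightarrow> (nat \<times> nat) list \<Rightarrow> nat \<times> nat" where
  "min_pivot val d N ps =
     (let qs = filter (\<lambda>p. p \<notin> set ps) (positions d)
      in hd (filter (\<lambda>p. \<forall>q\<in>set qs. val (N $$ p) \<le> val (N $$ q)) qs))"

text \<open>Left multiplication by this matrix subtracts multiples of row \<open>r\<close> so as to clear
  column \<open>c\<close> of \<open>N\<close> outside the position \<open>(r, c)\<close>.\<close>

definition row_elim :: "nat \<Rightarrow> 'a::field mat \<Rightarrow> nat \<times> nat \<Rightarrow> 'a mat" where
  "row_elim d N = (\<lambda>(r, c). mat d d (\<lambda>(k, l).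
     if k = l then 1 else if l = r then - (N $$ (k, c) / N $$ (r, c)) else 0))"

text \<open>Right multiplication by this matrix subtracts multiples of column \<open>c\<close> so as to clear
  row \<open>r\<close> of \<open>N\<close> outside the position \<open>(r, c)\<close>.\<close>

definition col_elim :: "nat \<Rightarrow> 'a::field mat \<Rightarrow> nat \<times> nat \<Rightarrow> 'a mat" where
  "col_elim d N = (\<lambda>(r, c). mat d d (\<lambda>(k, l).
     if k = l then 1 else if k = c then - (N $$ (r, l) / N $$ (r, c)) else 0))"

text \<open>The state after \<open>k\<close> steps: the current matrices \<open>B\<close> and \<open>C\<close> and the list of the
  positions of the first \<open>k\<close> pivots.\<close>

primrec sa_state ::
    "('a::field \<Rightarrow> int extended) \<Rightarrow> nat \<Rightarrow> 'a mat \<Rightarrow> 'a mat \<Rightarrow> nat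
      \<Rightarrow> 'a mat \<times> 'a mat \<times> (nat \<times> nat) list" where
  "sa_state val d P Q 0 = (P, Q, [])"
| "sa_state val d P Q (Suc k) =
     (let (B, C, ps) = sa_state val d P Q k;
          N = inv_mat B * C;
          p = min_pivot val d N ps;
          L = row_elim d N p;
          R = col_elim d (L * N) p
      in (B * inv_mat L, C * R, ps @ [p]))"

definition sa_basis :: "('a::field \<Rightarrow> int extended) \<Rightarrow> nat \<Rightarrow> 'a mat \<Rightarrow> 'a mat \<Rightarrow> 'a mat" where
  "sa_basis val d P Q = fst (sa_state val d P Q (d - 1))"

definition sa_base_change ::
    "('a::field \<Rightarrow> int extended) \<Rightarrow> nat \<Rightarrow> 'a mat \<Rightarrow> 'a mat \<Rightarrow> nat \<Rightarrow> 'a mat" where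
  "sa_base_change val d P Q j = (let (B, C, ps) = sa_state val d P Q j in inv_mat B * C)"

text \<open>The last pivot is the remaining nonzero entry of the final, monomial, matrix.\<close>

definition sa_pivots ::
    "('a::field \<Rightarrow> int extended) \<Rightarrow> nat \<Rightarrow> 'a mat \<Rightarrow> 'a mat \<Rightarrow> (nat \<times> nat) list" where
  "sa_pivots val d P Q =
     (let (B, C, ps) = sa_state val d P Q (d - 1);
          N = inv_mat B * C
      in ps @ [THE p. p \<in> set (positions d) - set ps \<and> N $$ p \<noteq> 0])"


section \<open>The convex-triangle algorithm\<close>

text \<open>\<open>A\<close> is a basis of the lattice of \<open>P\<close> and \<open>A * diag(\<pi>^c\<^sub>0, ..., \<pi>^c\<^sub>d\<^sub>-\<^sub>1)\<close> one of the lattice of \<open>Q\<close>.\<close>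

definition adapted_basis ::
    "('a::field \<Rightarrow> int extended) \<Rightarrow> 'a \<Rightarrow> nat \<Rightarrow> 'a mat \<Rightarrow> 'a mat \<Rightarrow> 'a mat \<Rightarrow> (nat \<Rightarrow> int) \<Rightarrow> bool" where
  "adapted_basis val \<pi> d P Q A c \<longleftrightarrow>
     A \<in> carrier_mat d d \<and> invertible_mat A \<and>
     col_lattice val A = col_lattice val P \<and>
     col_lattice val (A * mat_diag d (\<lambda>i. \<pi> powi c i)) = col_lattice val Q \<and>
     (\<forall>i j. i \<le> j \<and> j < d \<longrightarrow> c i \<le> c j)"

definition gamma_mat :: "'a::field \<Rightarrow> nat \<Rightarrow> (nat \<Rightarrow> int) \<Rightarrow> int \<Rightarrow> 'a mat" where
  "gamma_mat \<pi> d c l = mat_diag d (\<lambda>i. \<pi> powi (max l (c i)))"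

text \<open>The next increment \<open>t\<close> of \<open>\<lambda>\<close>, read off the SA-basis computation for \<open>(P, Q)\<close>, with \<open>t\<^sub>0\<close> the initial value of \<open>t\<close> and \<open>i\<close> the number
  of columns counted as the first ones. If \<open>v\<^sub>2\<close> is infinite then \<open>t\<close> is unchanged; \<open>v\<^sub>1\<close>, the
  valuation of a pivot, is always finite.\<close>

definition step_width ::
    "('a::field \<Rightarrow> int extended) \<Rightarrow> nat \<Rightarrow> 'a mat \<Rightarrow> 'a mat \<Rightarrow> nat \<Rightarrow> int \<Rightarrow> int" where
  "step_width val d P Q i t\<^sub>0 =
     (let ps = sa_pivots val d P Q in
      fold (\<lambda>j t.
        if snd (ps ! j) < i then
          (let N = sa_base_change val d P Q j;
               v1 = val (N $$ (ps ! j));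
               v2 = Min (insert Pinf {val (N $$ (r, s)) | r s.
                      r < d \<and> i \<le> s \<and> s < d \<and> (r, s) \<notin> set (take (Suc j) ps)})
           in case (v1, v2) of (Fin a, Fin b) \<Rightarrow> min t (b - a + 1) | _ \<Rightarrow> t)
        else t) [0..<d] t\<^sub>0)"

text \<open>The while loop for a given \<open>i\<close> between \<open>1\<close> and \<open>d - 1\<close>, acting on
  \<open>(\<lambda>, t, L)\<close>. Since \<open>c\<close> is indexed from \<open>0\<close>, the numbers \<open>c\<^sub>i\<close> and \<open>c\<^sub>i\<^sub>+\<^sub>1\<close> of the usual
  indexing are \<open>c (i - 1)\<close> and \<open>c i\<close>. The result is \<^const>\<open>None\<close> if the loop does not terminate.\<close>

definition triangle_loop ::
    "('a::field \<Rightarrow> int extended) \<Rightarrow> 'a \<Rightarrow> nat \<Rightarrow> 'a mat \<Rightarrow> 'a mat \<Rightarrow> (nat \<Rightarrow> int) \<Rightarrow> nat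
      \<Rightarrow> 'a vec set set set set \<Rightarrow> 'a vec set set set set option" where
  "triangle_loop val \<pi> d M A c i L\<^sub>0 =
     map_option (\<lambda>(l, t, L). L)
       (while_option
         (\<lambda>(l, t, L). l < c i)
         (\<lambda>(l, t, L).
            let l' = l + t;
                Q = A * gamma_mat \<pi> d c l'
            in (l', step_width val d M Q i (c i - c (i - 1)),
                insert (apartment val \<pi> d (sa_basis val d M Q)) L))
         (c (i - 1), 0, L\<^sub>0))"

text \<open>The main loop, run on the first input matrix \<open>M\<close> and on an adapted basis \<open>A\<close> with
  exponents \<open>c\<close> of the lattices of the second and third one.\<close>

definition convex_triangle ::
    "('a::field \<Rightarrow> int extended) \<Rightarrow> 'a \<Rightarrow> nat \<Rightarrow> 'a mat \<Rightarrow> 'a mat \<Rightarrow> (nat \<Rightarrow> int)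
      \<Rightarrow> 'a vec set set set set option" where
  "convex_triangle val \<pi> d M A c =
     fold (\<lambda>i res. Option.bind res (triangle_loop val \<pi> d M A c i)) [1..<d] (Some {})"

end

theory Submission
  imports Defs "Jordan_Normal_Form.Determinant"
begin

text \<open>Write \<open>\<Lambda>\<^sub>2\<close> and \<open>\<Lambda>\<^sub>3\<close> in an adapted basis \<open>A\<close>. Intersections of representatives of the three
  classes reduce, up to scaling, to \<open>\<pi>\<^sup>a \<Lambda>\<^sub>1\<close> intersected with the lattice of \<open>A \<Gamma>\<^sub>\<lambda>\<close>, and an SA-basis for
  \<open>(M\<^sub>1, A \<Gamma>\<^sub>\<lambda>)\<close> diagonalises both lattices at once. So the apartments for all integers \<open>\<lambda>\<close> cover
  the hull.

  Raising \<open>\<lambda>\<close> by \<open>t\<close> rescales by \<open>\<pi>\<^sup>t\<close> exactly the columns with \<open>c\<^sub>j \<le> \<lambda>\<close>, as long as no further \<open>c\<^sub>j\<close> is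
  passed. The pivots, and hence the SA-basis, stay the same while \<open>t \<le> v\<^sub>2 - v\<^sub>1\<close> for every pivot in
  these columns, so the values of \<open>\<lambda>\<close> that the algorithm skips contribute nothing new.

  For the bound, the SA-basis depends only on the set of steps whose pivot lies in the rescaled
  columns: the size of this set is the number of rescaled columns, and within either group of columns the
  scaling preserves the order of the candidates. Hence at most \<open>2\<^sup>d\<close> apartments occur over all
  \<open>\<lambda>\<close>, including values beyond \<open>c\<^sub>i\<^sub>+\<^sub>1\<close> that a loop may overshoot to.\<close>


section \<open>Invertible matrices\<close>

text \<open>A row of an elementary matrix has at most two nonzero entries, so an entry of a product
  with it has two summands. For \<open>k = r\<close> the diagonal 1 takes precedence over
  \<open>x\<close>.\<close>

lemma sum_elementary_row:
  fixes x :: "'b::comm_ring_1" and k r d :: nat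
  assumes "k < d" "r < d"
  shows "(\<Sum>l = 0..<d. (if k = l then 1 else if l = r then x else 0) * f l)
    = f k + (if k = r then 0 else x * f r)"
proof -
  have "(\<Sum>l = 0..<d. (if k = l then 1 else if l = r then x else 0) * f l)
      = (\<Sum>l = 0..<d. (if l = k then f l else 0) + (if l = r then (if k = r then 0 else x * f r) else 0))"
    by (rule sum.cong) auto
  also have "\<dots> = f k + (if k = r then 0 else x * f r)"
    using assms by (auto simp: sum.distrib)
  finally show ?thesis .
qed

text \<open>Links the existential \<open>invertible_mat\<close> to the computed
  \<open>mat_inverse\<close>: comparing dimensions makes the inverse square, so \<open>A\<close> is
  a unit of the matrix ring and the computation cannot fail.\<close>

lemma invertible_matD:
  assumes "A \<in> carrier_mat d d" "invertible_mat (A :: 'b::field mat)"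
  shows "inv_mat A \<in> carrier_mat d d" "A * inv_mat A = 1\<^sub>m d" "inv_mat A * A = 1\<^sub>m d"
proof -
  obtain B where B: "A * B = 1\<^sub>m d" "B * A = 1\<^sub>m (dim_row B)"
    using assms unfolding invertible_mat_def inverts_mat_def by auto
  have "dim_col B = d" using arg_cong[OF B(1), of dim_col] by simp
  moreover have "dim_row B = d" using arg_cong[OF B(2), of dim_col] assms by simp
  ultimately have "B \<in> carrier_mat d d" by auto
  hence "A \<in> Units (ring_mat TYPE('b) d ())"
    using B assms unfolding Units_def ring_mat_def by auto
  then obtain C where "mat_inverse A = Some C"
    using mat_inverse(1)[OF assms(1), where b = "()"] by (cases "mat_inverse A") auto
  then show "inv_mat A \<in> carrier_mat d d" "A * inv_mat A = 1\<^sub>m d" "inv_mat A * A = 1\<^sub>m d"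
    using mat_inverse(2)[OF assms(1)] by (auto simp: inv_mat_def)
qed

lemma invertible_matI:
  assumes "A \<in> carrier_mat d d" "B \<in> carrier_mat d d" "A * B = 1\<^sub>m d"
  shows "invertible_mat (A :: 'b::field mat)"
  using assms mat_mult_left_right_inverse[OF assms]
  unfolding invertible_mat_def inverts_mat_def by auto

lemma inv_mat_unique:
  assumes "A \<in> carrier_mat d d" "B \<in> carrier_mat d d" "A * B = 1\<^sub>m d"
  shows "inv_mat (A :: 'b::field mat) = B"
proof -
  note I = invertible_matD[OF assms(1) invertible_matI[OF assms]]
  have "inv_mat A = inv_mat A * (A * B)" using I assms(3) by simp
  also have "\<dots> = (inv_mat A * A) * B"
    using assoc_mult_mat[OF I(1) assms(1,2)] by simp
  also have "\<dots> = B" using I assms by simp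
  finally show ?thesis .
qed

lemma invertible_mat_mult:
  assumes "A \<in> carrier_mat d d" "B \<in> carrier_mat d d"
    "invertible_mat (A :: 'b::field mat)" "invertible_mat B"
  shows "invertible_mat (A * B)" "inv_mat (A * B) = inv_mat B * inv_mat A"
proof -
  note I = invertible_matD[OF assms(1,3)] and J = invertible_matD[OF assms(2,4)]
  have "(A * B) * (inv_mat B * inv_mat A) = A * ((B * inv_mat B) * inv_mat A)"
    using I(1) J(1) assms by (simp add: assoc_mult_mat[of _ d d _ d _ d])
  also have "\<dots> = 1\<^sub>m d" using I J by simp
  finally have "(A * B) * (inv_mat B * inv_mat A) = 1\<^sub>m d" .
  moreover have "A * B \<in> carrier_mat d d" "inv_mat B * inv_mat A \<in> carrier_mat d d"
    using I J assms by auto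
  ultimately show "invertible_mat (A * B)" "inv_mat (A * B) = inv_mat B * inv_mat A"
    by (blast intro: invertible_matI inv_mat_unique)+
qed

lemma invertible_mat_inv:
  assumes "A \<in> carrier_mat d d" "invertible_mat (A :: 'b::field mat)"
  shows "invertible_mat (inv_mat A)"
  using invertible_matI[of "inv_mat A" d A] invertible_matD[OF assms] assms by blast

lemma invertible_mult_vec_eq_0:
  assumes "A \<in> carrier_mat d d" "invertible_mat (A :: 'b::field mat)" "x \<in> carrier_vec d"
    "A *\<^sub>v x = 0\<^sub>v d"
  shows "x = 0\<^sub>v d"
proof -
  note I = invertible_matD[OF assms(1,2)]
  have "x = (inv_mat A * A) *\<^sub>v x" using I assms by simp
  also have "\<dots> = inv_mat A *\<^sub>v 0\<^sub>v d"
    using assoc_mult_mat_vec[OF I(1) assms(1,3)] assms(4) by simp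
  also have "\<dots> = 0\<^sub>v d" using I(1) by (intro eq_vecI) auto
  finally show ?thesis .
qed

text \<open>A zero column would put a unit vector into the kernel.\<close>

lemma invertible_col_nonzero:
  assumes "A \<in> carrier_mat d d" "invertible_mat (A :: 'b::field mat)" "s < d"
  shows "\<exists>k<d. A $$ (k, s) \<noteq> 0"
proof (rule ccontr)
  assume "\<not> ?thesis"
  hence "A *\<^sub>v unit_vec d s = 0\<^sub>v d" using assms by (intro eq_vecI) auto
  hence "unit_vec d s = (0\<^sub>v d :: 'b vec)"
    using invertible_mult_vec_eq_0[OF assms(1,2)] by simp
  from arg_cong[OF this, of "\<lambda>v. v $ s"] show False using assms by simp
qed

lemma invertible_mat_diag:
  assumes "\<And>i. i < d \<Longrightarrow> f i \<noteq> (0 :: 'b::field)"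
  shows "invertible_mat (mat_diag d f)"
proof (rule invertible_matI[of _ d "mat_diag d (\<lambda>i. inverse (f i))"])
  show "mat_diag d f * mat_diag d (\<lambda>i. inverse (f i)) = 1\<^sub>m d"
    using assms by (subst mat_diag_diag) (auto simp: mat_diag_def intro!: eq_matI)
qed auto

section \<open>Valuations and lattices in diagonal position\<close>

locale uniformized_valuation = discrete_valuation val
  for val :: "'a::field \<Rightarrow> int extended" +
  fixes \<pi> :: 'a
  assumes val_uniformizer: "val \<pi> = Fin 1"
begin

section \<open>Integer orders of nonzero elements\<close>

text \<open>Integer form of \<open>val\<close>, for linear arithmetic. At \<open>0\<close> it is
  unspecified, so zero is treated separately below.\<close>

definition ord :: "'a \<Rightarrow> int" where
  "ord x = (THE n. val x = Fin n)"

lemma val_eq_Fin: "x \<noteq> 0 \<Longrightarrow> val x = Fin (ord x)"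
  using val_eq_Pinf[of x] val_not_Minf[of x] unfolding ord_def by (cases "val x") auto

lemma val_0 [simp]: "val 0 = Pinf"
  using val_eq_Pinf by blast

lemma ord_eqI: "val x = Fin n \<Longrightarrow> ord x = n"
  unfolding ord_def by auto

lemma Fin_le_val_iff: "Fin n \<le> val x \<longleftrightarrow> x = 0 \<or> n \<le> ord x"
  by (cases "x = 0") (auto simp: val_eq_Fin)

lemma val_le_iff: "val x \<le> val y \<longleftrightarrow> y = 0 \<or> x \<noteq> 0 \<and> ord x \<le> ord y"
  by (cases "x = 0"; cases "y = 0") (auto simp: val_eq_Fin)

lemma ord_mult: "x \<noteq> 0 \<Longrightarrow> y \<noteq> 0 \<Longrightarrow> ord (x * y) = ord x + ord y"
  using val_mult[of x y] by (simp add: val_eq_Fin)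

lemma ord_1 [simp]: "ord 1 = 0"
  using ord_mult[of 1 1] by simp

lemma ord_minus [simp]: "ord (- x) = ord x"
proof (cases "x = 0")
  case False
  \<comment> \<open>Since \<open>(-1) * (-1) = 1\<close>, twice this order is
    \<open>ord 1 = 0\<close>.\<close>
  have "ord (-1) = 0" using ord_mult[of "-1" "-1"] by simp
  thus ?thesis using ord_mult[of "-1" x] False by simp
qed simp

lemma ord_inverse: "x \<noteq> 0 \<Longrightarrow> ord (inverse x) = - ord x"
  using ord_mult[of x "inverse x"] by simp

lemma ord_divide: "x \<noteq> 0 \<Longrightarrow> y \<noteq> 0 \<Longrightarrow> ord (x / y) = ord x - ord y"
  by (simp add: divide_inverse ord_mult ord_inverse)

lemma uniformizer_neq_0 [simp]: "\<pi> \<noteq> 0"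
  using val_uniformizer by auto

lemma ord_uniformizer_power: "ord (\<pi> ^ n) = int n"
  by (induction n) (simp_all add: ord_mult ord_eqI[OF val_uniformizer])

lemma ord_uniformizer_powi [simp]: "ord (\<pi> powi n) = n"
  by (simp add: power_int_def ord_uniformizer_power ord_inverse power_inverse)

lemma Fin_le_val_add: "Fin n \<le> val x \<Longrightarrow> Fin n \<le> val y \<Longrightarrow> Fin n \<le> val (x + y)"
  using val_add[of x y] by (meson min.boundedI order_trans)

lemma Fin_le_val_sum: "(\<And>i. i \<in> I \<Longrightarrow> Fin n \<le> val (f i)) \<Longrightarrow> Fin n \<le> val (sum f I)"
  by (induction I rule: infinite_finite_induct) (auto intro: Fin_le_val_add)

lemma Fin_le_val_mult: "Fin m \<le> val x \<Longrightarrow> Fin n \<le> val y \<Longrightarrow> Fin (m + n) \<le> val (x * y)"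
  by (cases "x = 0"; cases "y = 0") (auto simp: Fin_le_val_iff ord_mult)


lemma Fin_0_le_val_divide: "val y \<le> val x \<Longrightarrow> y \<noteq> 0 \<Longrightarrow> Fin 0 \<le> val (x / y)"
  by (cases "x = 0") (auto simp: Fin_le_val_iff val_le_iff ord_divide)


section \<open>Lattices given by exponents\<close>

text \<open>For invertible \<open>B\<close>, the lattice spanned by the columns of \<open>B\<close>
  scaled by \<open>\<pi> powi e i\<close>. Bounding coordinates instead of scaling columns turns
  scaling and intersection into arithmetic on \<open>e\<close>.\<close>

definition lat :: "'a mat \<Rightarrow> (nat \<Rightarrow> int) \<Rightarrow> 'a vec set" where
  "lat B e = {B *\<^sub>v x | x. x \<in> carrier_vec (dim_col B) \<and> (\<forall>i<dim_col B. Fin (e i) \<le> val (x $ i))}"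

lemma col_lattice_eq_lat: "col_lattice val B = lat B (\<lambda>_. 0)"
  unfolding col_lattice_def lat_def valuation_ring_def by (simp add: zero_extended_def)

lemma lat_cong: "(\<And>i. i < dim_col B \<Longrightarrow> e i = f i) \<Longrightarrow> lat B e = lat B f"
  unfolding lat_def by auto

lemma lat_mono: "(\<And>i. i < dim_col B \<Longrightarrow> f i \<le> e i) \<Longrightarrow> lat B e \<subseteq> lat B f"
  unfolding lat_def by (auto, metis less_eq_extended.simps(1) order_trans)

text \<open>One inclusion for every nonzero scalar suffices: used for \<open>inverse a\<close> and
  multiplied by \<open>a\<close>, it gives the other.\<close>

lemma smult_lat:
  assumes "a \<noteq> 0"
  shows "(\<lambda>v. a \<cdot>\<^sub>v v) ` lat B e = lat B (\<lambda>i. e i + ord a)"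
proof -
  let ?d = "dim_col B"
  have "(\<lambda>v. a \<cdot>\<^sub>v v) ` lat B e \<subseteq> lat B (\<lambda>i. e i + ord a)" if "a \<noteq> 0" for e a
  proof
    fix v assume "v \<in> (\<lambda>v. a \<cdot>\<^sub>v v) ` lat B e"
    then obtain x where x: "x \<in> carrier_vec ?d" "\<forall>i<?d. Fin (e i) \<le> val (x $ i)"
      "v = a \<cdot>\<^sub>v (B *\<^sub>v x)" unfolding lat_def by auto
    have "v = B *\<^sub>v (a \<cdot>\<^sub>v x)" using x by (auto simp: mult_mat_vec[of _ "dim_row B" ?d])
    moreover have "\<forall>i<?d. Fin (e i + ord a) \<le> val ((a \<cdot>\<^sub>v x) $ i)"
      using x that Fin_le_val_mult[of "ord a" a]
      by (auto simp: val_eq_Fin add.commute[of _ "ord a"])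
    ultimately show "v \<in> lat B (\<lambda>i. e i + ord a)" using x unfolding lat_def by auto
  qed
  note sub = this
  show ?thesis
  proof
    show "(\<lambda>v. a \<cdot>\<^sub>v v) ` lat B e \<subseteq> lat B (\<lambda>i. e i + ord a)" using sub assms by blast
    have "(\<lambda>v. inverse a \<cdot>\<^sub>v v) ` lat B (\<lambda>i. e i + ord a) \<subseteq> lat B e"
      using sub[of "inverse a" "\<lambda>i. e i + ord a"] assms by (simp add: ord_inverse)
    hence "(\<lambda>v. a \<cdot>\<^sub>v v) ` (\<lambda>v. inverse a \<cdot>\<^sub>v v) ` lat B (\<lambda>i. e i + ord a) \<subseteq> (\<lambda>v. a \<cdot>\<^sub>v v) ` lat B e"
      by (rule image_mono)
    thus "lat B (\<lambda>i. e i + ord a) \<subseteq> (\<lambda>v. a \<cdot>\<^sub>v v) ` lat B e"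
      using assms by (simp add: image_image smult_smult_assoc)
  qed
qed

text \<open>Coordinates with respect to an invertible \<open>B\<close> are unique, so a common
  element has one coordinate vector satisfying both bounds.\<close>

lemma lat_Int:
  assumes "B \<in> carrier_mat d d" "invertible_mat B"
  shows "lat B e \<inter> lat B f = lat B (\<lambda>i. max (e i) (f i))"
proof
  note I = invertible_matD[OF assms]
  have inj: "x = y" if "B *\<^sub>v x = B *\<^sub>v y" "x \<in> carrier_vec d" "y \<in> carrier_vec d" for x y
    using arg_cong[OF that(1), of "\<lambda>v. inv_mat B *\<^sub>v v"] that(2,3) I assms
    by (simp flip: assoc_mult_mat_vec[of _ d d _ d])
  show "lat B e \<inter> lat B f \<subseteq> lat B (\<lambda>i. max (e i) (f i))"
  proof
    fix v assume "v \<in> lat B e \<inter> lat B f"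
    then obtain x y where "x \<in> carrier_vec d" "y \<in> carrier_vec d" "v = B *\<^sub>v x" "v = B *\<^sub>v y"
      "\<forall>i<d. Fin (e i) \<le> val (x $ i)" "\<forall>i<d. Fin (f i) \<le> val (y $ i)"
      unfolding lat_def using assms by auto
    moreover from this inj have "x = y" by auto
    ultimately show "v \<in> lat B (\<lambda>i. max (e i) (f i))"
      unfolding lat_def using assms by (auto simp: Fin_le_val_iff intro!: exI[of _ x])
  qed
  show "lat B (\<lambda>i. max (e i) (f i)) \<subseteq> lat B e \<inter> lat B f"
    by (intro Int_greatest lat_mono) auto
qed

text \<open>Coordinates with respect to \<open>B\<close> and \<open>B * N\<close> differ by a
  permutation and by one nonzero factor each, so the bounds move by the orders of these factors.
  This covers diagonal scalings, column permutations and the final matrix of the SA-basis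
  algorithm.\<close>

lemma lat_monomial_mult:
  assumes B: "B \<in> carrier_mat d d" and N: "N \<in> carrier_mat d d"
    and \<sigma>: "bij_betw \<sigma> {..<d} {..<d}"
    and N0: "\<And>r s. r < d \<Longrightarrow> s < d \<Longrightarrow> N $$ (r, s) \<noteq> 0 \<longleftrightarrow> s = \<sigma> r"
  shows "lat (B * N) e = lat B (\<lambda>r. e (\<sigma> r) + ord (N $$ (r, \<sigma> r)))"
proof -
  have \<sigma>_lt: "r < d \<Longrightarrow> \<sigma> r < d" for r using bij_betwE[OF \<sigma>] by blast
  have Nv: "(N *\<^sub>v x) $ r = N $$ (r, \<sigma> r) * x $ (\<sigma> r)" if "x \<in> carrier_vec d" "r < d" for x r
  proof -
    have "(N *\<^sub>v x) $ r = (\<Sum>s = 0..<d. N $$ (r, s) * x $ s)"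
      using that N by (simp add: scalar_prod_def)
    also have "\<dots> = (\<Sum>s\<in>{\<sigma> r}. N $$ (r, s) * x $ s)"
    proof (rule sum.mono_neutral_right)
      show "\<forall>s\<in>{0..<d} - {\<sigma> r}. N $$ (r, s) * x $ s = 0" using N0 that by force
    qed (use \<sigma>_lt that in auto)
    finally show ?thesis by simp
  qed
  have BN: "(B * N) *\<^sub>v x = B *\<^sub>v (N *\<^sub>v x)" if "x \<in> carrier_vec d" for x
    using that B N by (simp add: assoc_mult_mat_vec[of _ d d _ d])
  let ?f = "\<lambda>r. e (\<sigma> r) + ord (N $$ (r, \<sigma> r))"
  show ?thesis
  proof
    show "lat (B * N) e \<subseteq> lat B ?f"
    proof
      fix v assume "v \<in> lat (B * N) e"
      then obtain x where x: "x \<in> carrier_vec d" "\<forall>i<d. Fin (e i) \<le> val (x $ i)" "v = (B * N) *\<^sub>v x"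
        unfolding lat_def using B N by auto
      have "Fin (?f r) \<le> val ((N *\<^sub>v x) $ r)" if "r < d" for r
        using x that N0[of r "\<sigma> r"] \<sigma>_lt[of r] unfolding Nv[OF x(1) that]
        by (cases "x $ \<sigma> r = 0") (auto simp: Fin_le_val_iff ord_mult)
      moreover have "v = B *\<^sub>v (N *\<^sub>v x)" using x BN by simp
      moreover have "N *\<^sub>v x \<in> carrier_vec d" using N x by simp
      ultimately show "v \<in> lat B ?f" unfolding lat_def using B by auto
    qed
    show "lat B ?f \<subseteq> lat (B * N) e"
    proof
      fix v assume "v \<in> lat B ?f"
      then obtain y where y: "y \<in> carrier_vec d" "\<forall>i<d. Fin (?f i) \<le> val (y $ i)" "v = B *\<^sub>v y"
        unfolding lat_def using B by auto
      define \<tau> where "\<tau> = inv_into {..<d} \<sigma>"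
      have \<tau>: "\<tau> s < d" "\<sigma> (\<tau> s) = s" if "s < d" for s
        using that \<sigma> inv_into_into[of s \<sigma> "{..<d}"] f_inv_into_f[of s \<sigma> "{..<d}"]
        unfolding \<tau>_def bij_betw_def by auto
      have \<tau>\<sigma>: "\<tau> (\<sigma> r) = r" if "r < d" for r
        using that \<sigma> unfolding \<tau>_def bij_betw_def by (simp add: inv_into_f_f)
      \<comment> \<open>The solution of \<open>N *\<^sub>v x = y\<close>: the nonzero entry of
        column \<open>s\<close> lies in row \<open>\<tau> s\<close>.\<close>
      define x where "x = vec d (\<lambda>s. y $ (\<tau> s) / N $$ (\<tau> s, s))"
      have x: "x \<in> carrier_vec d" unfolding x_def by simp
      have "N *\<^sub>v x = y"
      proof (rule eq_vecI)
        fix r assume "r < dim_vec y"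
        hence r: "r < d" using y by simp
        thus "(N *\<^sub>v x) $ r = y $ r"
          unfolding Nv[OF x r] using \<sigma>_lt[OF r] \<tau>\<sigma>[OF r] N0[of r "\<sigma> r"] by (simp add: x_def)
      qed (use N y in simp)
      hence "v = (B * N) *\<^sub>v x" using y BN[OF x] by simp
      moreover have "Fin (e s) \<le> val (x $ s)" if "s < d" for s
      proof -
        have "N $$ (\<tau> s, s) \<noteq> 0" using N0[of "\<tau> s" s] \<tau>[OF that] that by simp
        moreover have "Fin (?f (\<tau> s)) \<le> val (y $ \<tau> s)" using y \<tau>[OF that] by blast
        ultimately show ?thesis
          unfolding x_def using that \<tau>[OF that]
          by (cases "y $ \<tau> s = 0") (auto simp: Fin_le_val_iff ord_divide)
      qed
      ultimately show "v \<in> lat (B * N) e" unfolding lat_def using x N by auto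
    qed
  qed
qed

text \<open>The case of the identity permutation. It makes the members of an apartment the classes
  of \<open>lat B e\<close> with arbitrary exponents \<open>e\<close>.\<close>

lemma col_lattice_diag:
  assumes "B \<in> carrier_mat d d"
  shows "col_lattice val (B * mat_diag d (\<lambda>i. \<pi> powi e i)) = lat B e"
proof -
  have "lat (B * mat_diag d (\<lambda>i. \<pi> powi e i)) (\<lambda>_. 0)
      = lat B (\<lambda>r. 0 + ord (mat_diag d (\<lambda>i. \<pi> powi e i) $$ (r, id r)))"
    by (rule lat_monomial_mult[OF assms]) (auto simp: mat_diag_def simp flip: id_def)
  also have "\<dots> = lat B e"
    using assms by (intro lat_cong) (auto simp: mat_diag_def)
  finally show ?thesis unfolding col_lattice_eq_lat .
qed

lemma col_lattice_mult_integral: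
  assumes "B \<in> carrier_mat d d" "U \<in> carrier_mat d d"
    "\<And>i j. i < d \<Longrightarrow> j < d \<Longrightarrow> Fin 0 \<le> val (U $$ (i, j))"
  shows "col_lattice val (B * U) \<subseteq> col_lattice val B"
proof
  fix v assume "v \<in> col_lattice val (B * U)"
  then obtain x where x: "x \<in> carrier_vec d" "\<forall>i<d. Fin 0 \<le> val (x $ i)" "v = (B * U) *\<^sub>v x"
    unfolding col_lattice_eq_lat lat_def using assms by auto
  have "v = B *\<^sub>v (U *\<^sub>v x)" using x assms by (simp add: assoc_mult_mat_vec[of _ d d _ d])
  moreover have "Fin 0 \<le> val ((U *\<^sub>v x) $ i)" if "i < d" for i
    using x assms that Fin_le_val_mult[of 0 _ 0]
    by (auto simp: scalar_prod_def intro!: Fin_le_val_sum)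
  moreover have "U *\<^sub>v x \<in> carrier_vec d" using assms x by simp
  ultimately show "v \<in> col_lattice val B"
    unfolding col_lattice_eq_lat lat_def using assms by auto
qed

text \<open>The inclusion for integral matrices applies twice, to \<open>U\<close> on
  \<open>B\<close> and to \<open>V\<close> on \<open>B * U\<close>.\<close>

lemma col_lattice_mult_unimodular:
  assumes "B \<in> carrier_mat d d" "U \<in> carrier_mat d d" "V \<in> carrier_mat d d" "U * V = 1\<^sub>m d"
    "\<And>i j. i < d \<Longrightarrow> j < d \<Longrightarrow> Fin 0 \<le> val (U $$ (i, j))"
    "\<And>i j. i < d \<Longrightarrow> j < d \<Longrightarrow> Fin 0 \<le> val (V $$ (i, j))"
  shows "col_lattice val (B * U) = col_lattice val B"
proof
  show "col_lattice val (B * U) \<subseteq> col_lattice val B"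
    using assms by (intro col_lattice_mult_integral[of _ d])
  have "(B * U) * V = B" using assms by (simp add: assoc_mult_mat[of _ d d _ d _ d])
  thus "col_lattice val B \<subseteq> col_lattice val (B * U)"
    using col_lattice_mult_integral[of "B * U" d V] assms by auto
qed

end

section \<open>Pivots and elementary matrices\<close>

text \<open>The tie-breaking rule of the pivot choice, which is also the order of the list
  \<open>positions\<close>.\<close>

definition pos_less :: "nat \<times> nat \<Rightarrow> nat \<times> nat \<Rightarrow> bool" where
  "pos_less p q \<longleftrightarrow> snd p < snd q \<or> snd p = snd q \<and> fst p < fst q"

lemma set_positions: "set (positions d) = {..<d} \<times> {..<d}"
  unfolding positions_def by auto

lemma sorted_wrt_positions: "sorted_wrt pos_less (positions d)"
proof -
  have "sorted_wrt (<) xs \<Longrightarrow> sorted_wrt (<) ys \<Longrightarrow>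
      sorted_wrt pos_less (concat (map (\<lambda>c. map (\<lambda>r. (r, c)) xs) ys))" for xs ys :: "nat list"
    by (induction ys) (auto simp: sorted_wrt_append sorted_wrt_map pos_less_def)
  moreover have "positions d = concat (map (\<lambda>c. map (\<lambda>r. (r, c)) [0..<d]) [0..<d])"
    unfolding positions_def by simp
  ultimately show ?thesis by (simp add: strict_sorted_iff)
qed

lemma hd_filter_sorted_wrt:
  assumes "sorted_wrt R xs" "x \<in> set xs" "P x"
  shows "hd (filter P xs) \<in> set xs" "P (hd (filter P xs))"
    "x = hd (filter P xs) \<or> R (hd (filter P xs)) x"
proof -
  have x: "x \<in> set (filter P xs)" using assms by simp
  then obtain y ys where ys: "filter P xs = y # ys" by (cases "filter P xs") auto
  have "y \<in> set (filter P xs)" unfolding ys by simp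
  hence "y \<in> set xs" "P y" by simp_all
  thus "hd (filter P xs) \<in> set xs" "P (hd (filter P xs))" unfolding ys by simp_all
  have "sorted_wrt R (y # ys)" using sorted_wrt_filter[OF assms(1), of P] ys by simp
  thus "x = hd (filter P xs) \<or> R (hd (filter P xs)) x" using x unfolding ys by auto
qed

definition pivot_before ::
    "('a::field \<Rightarrow> int extended) \<Rightarrow> 'a mat \<Rightarrow> nat \<times> nat \<Rightarrow> nat \<times> nat \<Rightarrow> bool" where
  "pivot_before val N p q \<longleftrightarrow>
     val (N $$ p) < val (N $$ q) \<or> val (N $$ p) = val (N $$ q) \<and> (p = q \<or> pos_less p q)"

lemma pivot_before_antisym: "pivot_before val N p q \<Longrightarrow> pivot_before val N q p \<Longrightarrow> p = q"
  unfolding pivot_before_def pos_less_def by (auto simp: prod_eq_iff)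

lemma pivot_before_imp_le: "pivot_before val N p q \<Longrightarrow> val (N $$ p) \<le> val (N $$ q)"
  unfolding pivot_before_def by auto

definition unused_positions :: "nat \<Rightarrow> (nat \<times> nat) set \<Rightarrow> (nat \<times> nat) set" where
  "unused_positions d S = {..<d} \<times> {..<d} - S"

lemma unused_positionsI:
  assumes "r < d" "s < d" "r \<notin> fst ` S \<or> s \<notin> snd ` S"
  shows "(r, s) \<in> unused_positions d S"
  using assms unfolding unused_positions_def by force

text \<open>Filtering with \<open>P\<close> keeps the positions of minimal valuation, and the head
  is the first of them in column-major order. A position that fails \<open>P\<close> already loses
  by valuation.\<close>

lemma min_pivot_props:
  assumes "unused_positions d (set ps) \<noteq> {}"
  shows "min_pivot val d N ps \<in> unused_positions d (set ps)"
    and "q \<in> unused_positions d (set ps) \<Longrightarrow> pivot_before val N (min_pivot val d N ps) q"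
proof -
  define qs where "qs = filter (\<lambda>p. p \<notin> set ps) (positions d)"
  define P where "P = (\<lambda>p. \<forall>q\<in>set qs. val (N $$ p) \<le> val (N $$ q))"
  have set_qs: "set qs = unused_positions d (set ps)"
    unfolding qs_def unused_positions_def set_positions[symmetric] by auto
  have sorted: "sorted_wrt pos_less qs"
    unfolding qs_def by (rule sorted_wrt_filter[OF sorted_wrt_positions])
  have mp: "min_pivot val d N ps = hd (filter P qs)"
    unfolding min_pivot_def qs_def[symmetric] Let_def P_def ..
  let ?V = "(\<lambda>p. val (N $$ p)) ` set qs"
  have "Min ?V \<in> ?V" using assms unfolding set_qs[symmetric] by (intro Min_in) auto
  then obtain p where "p \<in> set qs" "val (N $$ p) = Min ?V" by auto
  hence p: "p \<in> set qs" "P p" unfolding P_def by auto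
  show "min_pivot val d N ps \<in> unused_positions d (set ps)"
    using hd_filter_sorted_wrt(1)[of _ _ _ P, OF sorted p] unfolding mp set_qs .
  have hd: "P (min_pivot val d N ps)"
    using hd_filter_sorted_wrt(2)[of _ _ _ P, OF sorted p] unfolding mp .
  show "pivot_before val N (min_pivot val d N ps) q" if "q \<in> unused_positions d (set ps)"
  proof (cases "P q")
    case True
    hence "val (N $$ q) = val (N $$ min_pivot val d N ps)"
      using hd hd_filter_sorted_wrt(1)[of _ _ _ P, OF sorted p] that unfolding set_qs[symmetric] mp P_def
      by (meson order_antisym)
    thus ?thesis using hd_filter_sorted_wrt(3)[of _ _ _ P, OF sorted _ True] that
      unfolding set_qs[symmetric] mp pivot_before_def by auto
  next
    case False
    then obtain q' where "q' \<in> set qs" "val (N $$ q') < val (N $$ q)"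
      unfolding P_def by (meson not_le)
    thus ?thesis using hd unfolding P_def pivot_before_def by (meson le_less_trans)
  qed
qed

lemma min_pivot_eqI:
  assumes "p \<in> unused_positions d (set ps)"
    "\<And>q. q \<in> unused_positions d (set ps) \<Longrightarrow> pivot_before val N p q"
  shows "min_pivot val d N ps = p"
  using min_pivot_props(1)[of d ps val N] min_pivot_props(2)[of d ps _ val N] assms pivot_before_antisym by blast


section \<open>Elementary matrices\<close>

text \<open>\<open>row_elim\<close> with free coefficients, so that the inverse is the same matrix
  with the coefficients negated.\<close>

definition elementary_row :: "nat \<Rightarrow> nat \<Rightarrow> (nat \<Rightarrow> 'b::field) \<Rightarrow> 'b mat" where
  "elementary_row d r a = mat d d (\<lambda>(k, l). if k = l then 1 else if l = r then a k else 0)"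

definition elementary_col :: "nat \<Rightarrow> nat \<Rightarrow> (nat \<Rightarrow> 'b::field) \<Rightarrow> 'b mat" where
  "elementary_col d c b = mat d d (\<lambda>(k, l). if k = l then 1 else if k = c then b l else 0)"

lemma elementary_carrier [simp]:
  "elementary_row d r a \<in> carrier_mat d d" "elementary_col d c b \<in> carrier_mat d d"
  unfolding elementary_row_def elementary_col_def by auto

lemma elementary_row_mult:
  assumes "X \<in> carrier_mat d n" "r < d" "k < d" "s < n"
  shows "(elementary_row d r a * X) $$ (k, s)
    = X $$ (k, s) + (if k = r then 0 else a k * X $$ (r, s))"
proof -
  have "(elementary_row d r a * X) $$ (k, s)
      = (\<Sum>l = 0..<d. (if k = l then 1 else if l = r then a k else 0) * X $$ (l, s))"
    using assms by (auto simp: elementary_row_def scalar_prod_def intro!: sum.cong)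
  thus ?thesis using sum_elementary_row[OF assms(3,2), of "a k" "\<lambda>l. X $$ (l, s)"] by simp
qed

lemma elementary_col_mult:
  assumes "X \<in> carrier_mat n d" "c < d" "k < n" "s < d"
  shows "(X * elementary_col d c b) $$ (k, s)
    = X $$ (k, s) + (if s = c then 0 else X $$ (k, c) * b s)"
proof -
  have "(X * elementary_col d c b) $$ (k, s)
      = (\<Sum>l = 0..<d. (if s = l then 1 else if l = c then b s else 0) * X $$ (k, l))"
    using assms by (auto simp: elementary_col_def scalar_prod_def intro!: sum.cong)
  thus ?thesis using sum_elementary_row[OF assms(4,2), of "b s" "\<lambda>l. X $$ (k, l)"]
    by (simp add: mult.commute)
qed

lemma elementary_row_inverse:
  assumes "r < d"
  shows "elementary_row d r a * elementary_row d r (\<lambda>k. - a k) = 1\<^sub>m d"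
proof (rule eq_matI)
  fix i j assume "i < dim_row (1\<^sub>m d :: 'a mat)" "j < dim_col (1\<^sub>m d :: 'a mat)"
  thus "(elementary_row d r a * elementary_row d r (\<lambda>k. - a k)) $$ (i, j) = 1\<^sub>m d $$ (i, j)"
    using assms by (subst elementary_row_mult[of _ d d]) (auto simp: elementary_row_def)
qed (auto simp: elementary_row_def)

lemma elementary_col_inverse:
  assumes "c < d"
  shows "elementary_col d c b * elementary_col d c (\<lambda>k. - b k) = 1\<^sub>m d"
proof (rule eq_matI)
  fix i j assume "i < dim_row (1\<^sub>m d :: 'a mat)" "j < dim_col (1\<^sub>m d :: 'a mat)"
  thus "(elementary_col d c b * elementary_col d c (\<lambda>k. - b k)) $$ (i, j) = 1\<^sub>m d $$ (i, j)"
    using assms by (subst elementary_col_mult[of _ d d]) (auto simp: elementary_col_def)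
qed (auto simp: elementary_col_def)

lemma row_elim_eq:
  "row_elim d N (r, c) = elementary_row d r (\<lambda>k. - (N $$ (k, c) / N $$ (r, c)))"
  unfolding row_elim_def elementary_row_def by simp

lemma col_elim_eq:
  "col_elim d N (r, c) = elementary_col d c (\<lambda>l. - (N $$ (r, l) / N $$ (r, c)))"
  unfolding col_elim_def elementary_col_def by simp

section \<open>Correctness of the SA-basis algorithm\<close>

locale sa_run = uniformized_valuation +
  fixes d :: nat and P Q :: "'a mat"
  assumes P_carrier: "P \<in> carrier_mat d d" and P_inv: "invertible_mat P"
    and Q_carrier: "Q \<in> carrier_mat d d" and Q_inv: "invertible_mat Q"
begin

definition Bs :: "nat \<Rightarrow> 'a mat" where
  "Bs k = fst (sa_state val d P Q k)"

definition Cs :: "nat \<Rightarrow> 'a mat" where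
  "Cs k = fst (snd (sa_state val d P Q k))"

definition Ns :: "nat \<Rightarrow> 'a mat" where
  "Ns k = inv_mat (Bs k) * Cs k"

definition pivot :: "nat \<Rightarrow> nat \<times> nat" where
  "pivot k = min_pivot val d (Ns k) (snd (snd (sa_state val d P Q k)))"

lemma sa_state_0: "Bs 0 = P" "Cs 0 = Q"
  unfolding Bs_def Cs_def by simp_all

lemma sa_state_Suc:
  "Bs (Suc k) = Bs k * inv_mat (row_elim d (Ns k) (pivot k))"
  "Cs (Suc k) = Cs k * col_elim d (row_elim d (Ns k) (pivot k) * Ns k) (pivot k)"
  unfolding Bs_def Cs_def Ns_def pivot_def by (simp_all add: Let_def split_def)

lemma sa_state_pivots: "snd (snd (sa_state val d P Q k)) = map pivot [0..<k]"
  by (induction k) (simp_all add: Let_def split_def pivot_def Ns_def Bs_def Cs_def)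

lemma pivot_eq: "pivot k = min_pivot val d (Ns k) (map pivot [0..<k])"
  using pivot_def[of k] unfolding sa_state_pivots .

section \<open>The invariant of the elimination\<close>

text \<open>Besides preserving both lattices, each step leaves a pivot alone in its row and column.
  Later steps then cannot disturb it, and the matrix becomes monomial.\<close>

definition invariant :: "nat \<Rightarrow> bool" where
  "invariant k \<longleftrightarrow>
    Bs k \<in> carrier_mat d d \<and> invertible_mat (Bs k) \<and>
    Cs k \<in> carrier_mat d d \<and> invertible_mat (Cs k) \<and>
    col_lattice val (Bs k) = col_lattice val P \<and> col_lattice val (Cs k) = col_lattice val Q \<and>
    inj_on (\<lambda>j. fst (pivot j)) {..<k} \<and> inj_on (\<lambda>j. snd (pivot j)) {..<k} \<and>
    (\<forall>j<k. fst (pivot j) < d \<and> snd (pivot j) < d \<and> Ns k $$ pivot j \<noteq> 0 \<and>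
      (\<forall>s<d. s \<noteq> snd (pivot j) \<longrightarrow> Ns k $$ (fst (pivot j), s) = 0) \<and>
      (\<forall>r<d. r \<noteq> fst (pivot j) \<longrightarrow> Ns k $$ (r, snd (pivot j)) = 0))"

lemma Ns_props:
  assumes "invariant k"
  shows "Ns k \<in> carrier_mat d d" "invertible_mat (Ns k)" "Bs k * Ns k = Cs k"
proof -
  have B: "Bs k \<in> carrier_mat d d" "invertible_mat (Bs k)"
    and C: "Cs k \<in> carrier_mat d d" "invertible_mat (Cs k)"
    using assms unfolding invariant_def by auto
  note I = invertible_matD[OF B]
  show "Ns k \<in> carrier_mat d d" unfolding Ns_def using I C by simp
  show "invertible_mat (Ns k)" unfolding Ns_def
    by (rule invertible_mat_mult[OF I(1) C(1) invertible_mat_inv[OF B] C(2)])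
  show "Bs k * Ns k = Cs k"
    unfolding Ns_def using assoc_mult_mat[OF B(1) I(1) C(1)] I C by simp
qed

lemma pivot_props:
  assumes "invariant k" "k < d"
  shows "pivot k \<in> unused_positions d (pivot ` {..<k})"
    and "\<And>q. q \<in> unused_positions d (pivot ` {..<k}) \<Longrightarrow> pivot_before val (Ns k) (pivot k) q"
    and "Ns k $$ pivot k \<noteq> 0"
    and "fst (pivot k) < d" "snd (pivot k) < d"
    and "\<And>j. j < k \<Longrightarrow> fst (pivot j) \<noteq> fst (pivot k)"
    and "\<And>j. j < k \<Longrightarrow> snd (pivot j) \<noteq> snd (pivot k)"
proof -
  have set: "set (map pivot [0..<k]) = pivot ` {..<k}" by (simp add: lessThan_atLeast0)
  have "card ((\<lambda>j. snd (pivot j)) ` {..<k}) < card {..<d}"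
    using assms(2) card_image_le[of "{..<k}" "\<lambda>j. snd (pivot j)"] by simp
  then obtain s where s: "s < d" "s \<notin> (\<lambda>j. snd (pivot j)) ` {..<k}"
    by (metis card_mono finite_imageI finite_lessThan lessThan_iff not_le subsetI)
  obtain r where r: "r < d" "Ns k $$ (r, s) \<noteq> 0"
    using invertible_col_nonzero[OF Ns_props(1,2)[OF assms(1)] s(1)] by auto
  have rs: "(r, s) \<in> unused_positions d (pivot ` {..<k})"
    using r s by (intro unused_positionsI) (auto simp: image_image)
  hence ne: "unused_positions d (set (map pivot [0..<k])) \<noteq> {}" unfolding set by auto
  show A: "pivot k \<in> unused_positions d (pivot ` {..<k})"
    using min_pivot_props(1)[OF ne, of val "Ns k"] unfolding set pivot_eq[symmetric] .
  show B: "pivot_before val (Ns k) (pivot k) q" if "q \<in> unused_positions d (pivot ` {..<k})" for q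
    using min_pivot_props(2)[OF ne, of q val "Ns k"] that unfolding set pivot_eq[symmetric] .
  show C: "Ns k $$ pivot k \<noteq> 0"
    using pivot_before_imp_le[OF B[OF rs]] r(2) unfolding val_le_iff by auto
  show D: "fst (pivot k) < d" "snd (pivot k) < d"
    using A unfolding unused_positions_def by auto
  show "fst (pivot j) \<noteq> fst (pivot k)" if "j < k" for j
  proof
    assume eq: "fst (pivot j) = fst (pivot k)"
    moreover have "pivot k \<noteq> pivot j" using A that unfolding unused_positions_def by auto
    ultimately have "snd (pivot k) \<noteq> snd (pivot j)" by (simp add: prod_eq_iff)
    hence "Ns k $$ (fst (pivot j), snd (pivot k)) = 0"
      using assms(1) that D unfolding invariant_def by blast
    thus False using C eq by simp
  qed
  show "snd (pivot j) \<noteq> snd (pivot k)" if "j < k" for j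
  proof
    assume eq: "snd (pivot j) = snd (pivot k)"
    moreover have "pivot k \<noteq> pivot j" using A that unfolding unused_positions_def by auto
    ultimately have "fst (pivot k) \<noteq> fst (pivot j)" by (simp add: prod_eq_iff)
    hence "Ns k $$ (fst (pivot k), snd (pivot j)) = 0"
      using assms(1) that D unfolding invariant_def by blast
    thus False using C eq by simp
  qed
qed

text \<open>The multipliers are quotients by an entry of least valuation, hence integral. The
  elementary matrices and their inverses are therefore integral and keep both lattices.\<close>

lemma invariant_Suc:
  assumes inv: "invariant k" and k: "k < d"
  shows "invariant (Suc k)"
proof -
  obtain r c where rc: "pivot k = (r, c)" by (cases "pivot k")
  note pp = pivot_props[OF inv k, unfolded rc fst_conv snd_conv]
  have B: "Bs k \<in> carrier_mat d d" "invertible_mat (Bs k)"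
    and C: "Cs k \<in> carrier_mat d d" "invertible_mat (Cs k)"
    and lats: "col_lattice val (Bs k) = col_lattice val P" "col_lattice val (Cs k) = col_lattice val Q"
    and old: "\<And>j. j < k \<Longrightarrow> fst (pivot j) < d" "\<And>j. j < k \<Longrightarrow> snd (pivot j) < d"
      "\<And>j. j < k \<Longrightarrow> Ns k $$ (fst (pivot j), snd (pivot j)) \<noteq> 0"
      "\<And>j s. j < k \<Longrightarrow> s < d \<Longrightarrow> s \<noteq> snd (pivot j) \<Longrightarrow> Ns k $$ (fst (pivot j), s) = 0"
      "\<And>j s. j < k \<Longrightarrow> s < d \<Longrightarrow> s \<noteq> fst (pivot j) \<Longrightarrow> Ns k $$ (s, snd (pivot j)) = 0"
    using inv unfolding invariant_def by auto
  note N = Ns_props[OF inv]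
  define a where "a = (\<lambda>i. Ns k $$ (i, c) / Ns k $$ (r, c))"
  define L where "L = elementary_row d r (\<lambda>i. - a i)"
  define L' where "L' = elementary_row d r a"
  have L_eq: "row_elim d (Ns k) (r, c) = L"
    unfolding row_elim_eq L_def a_def ..
  have LL': "L * L' = 1\<^sub>m d"
    using elementary_row_inverse[OF pp(4), of "\<lambda>i. - a i"] unfolding L_def L'_def by simp
  have Lc: "L \<in> carrier_mat d d" "L' \<in> carrier_mat d d" unfolding L_def L'_def by simp_all
  have invL: "inv_mat L = L'" by (rule inv_mat_unique[OF Lc LL'])
  have L'L: "L' * L = 1\<^sub>m d" by (rule mat_mult_left_right_inverse[OF Lc LL'])
  have LN: "(L * Ns k) $$ (i, s) = Ns k $$ (i, s) - (if i = r then 0 else a i * Ns k $$ (r, s))"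
    if "i < d" "s < d" for i s
    unfolding L_def using elementary_row_mult[OF N(1) pp(4) that, of "\<lambda>i. - a i"] by simp
  define b where "b = (\<lambda>s. Ns k $$ (r, s) / Ns k $$ (r, c))"
  define R where "R = elementary_col d c (\<lambda>s. - b s)"
  define R' where "R' = elementary_col d c b"
  \<comment> \<open>The row step leaves row \<open>r\<close> itself unchanged, so the coefficients
    of the column step can be read off \<open>Ns k\<close>.\<close>
  have "mat d d (\<lambda>(k', l). if k' = l then 1 else if k' = c then - ((L * Ns k) $$ (r, l) / (L * Ns k) $$ (r, c)) else 0) = R"
    unfolding R_def elementary_col_def b_def using pp(4,5) by (intro eq_matI) (auto simp: LN)
  hence R_eq: "col_elim d (L * Ns k) (r, c) = R"
    unfolding col_elim_def by simp
  have RR': "R * R' = 1\<^sub>m d"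
    using elementary_col_inverse[OF pp(5), of "\<lambda>i. - b i"] unfolding R_def R'_def by simp
  have Rc: "R \<in> carrier_mat d d" "R' \<in> carrier_mat d d" unfolding R_def R'_def by simp_all
  have Suc_eq: "Bs (Suc k) = Bs k * L'" "Cs (Suc k) = Cs k * R"
    unfolding sa_state_Suc rc L_eq invL R_eq by simp_all
  have inv_L': "invertible_mat L'" "inv_mat L' = L"
    using invertible_matI[OF Lc(2,1) L'L] inv_mat_unique[OF Lc(2,1) L'L] .
  have inv_R: "invertible_mat R" using invertible_matI[OF Rc RR'] .
  note IB = invertible_matD[OF B]
  have "Ns (Suc k) = (L * inv_mat (Bs k)) * (Cs k * R)"
    unfolding Ns_def Suc_eq invertible_mat_mult(2)[OF B(1) Lc(2) B(2) inv_L'(1)] inv_L' ..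
  also have "\<dots> = L * (inv_mat (Bs k) * (Cs k * R))"
    using Lc IB C Rc by (intro assoc_mult_mat) auto
  also have "inv_mat (Bs k) * (Cs k * R) = Ns k * R"
    unfolding Ns_def using IB C Rc by (intro assoc_mult_mat[symmetric]) auto
  also have "L * (Ns k * R) = (L * Ns k) * R"
    using Lc N Rc by (intro assoc_mult_mat[symmetric]) auto
  finally have N_Suc: "Ns (Suc k) = (L * Ns k) * R" .
  \<comment> \<open>Outside the cross through the pivot this is the Schur complement.\<close>
  have entry: "Ns (Suc k) $$ (i, s) =
      (if i = r \<and> s = c then Ns k $$ (r, c) else if i = r \<or> s = c then 0
       else Ns k $$ (i, s) - a i * Ns k $$ (r, s))" if "i < d" "s < d" for i s
  proof -
    have LNc: "L * Ns k \<in> carrier_mat d d" using Lc N by simp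
    show ?thesis
      unfolding N_Suc R_def elementary_col_mult[OF LNc pp(5) that] LN[OF that] LN[OF that(1) pp(5)]
      using pp(3) by (auto simp: a_def b_def)
  qed
  have a_int: "Fin 0 \<le> val (a i)" if "i < d" for i
  proof -
    \<comment> \<open>Column \<open>c\<close> holds no earlier pivot, so all its entries competed
      with the chosen one.\<close>
    have "(i, c) \<in> unused_positions d (pivot ` {..<k})"
      using that pp(5) by (rule unused_positionsI) (use pp(7) in fastforce)
    thus ?thesis unfolding a_def
      using pivot_before_imp_le[OF pp(2)] pp(3) by (intro Fin_0_le_val_divide)
  qed
  have b_int: "Fin 0 \<le> val (b s)" if "s < d" for s
  proof -
    have "(r, s) \<in> unused_positions d (pivot ` {..<k})"
      using pp(4) that by (rule unused_positionsI) (use pp(6) in fastforce)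
    thus ?thesis unfolding b_def
      using pivot_before_imp_le[OF pp(2)] pp(3) by (intro Fin_0_le_val_divide)
  qed
  have neg: "Fin 0 \<le> val (- x)" if "Fin 0 \<le> val x" for x
    using that by (simp add: Fin_le_val_iff)
  have lats': "col_lattice val (Bs (Suc k)) = col_lattice val P"
      "col_lattice val (Cs (Suc k)) = col_lattice val Q"
    unfolding Suc_eq lats[symmetric]
    using col_lattice_mult_unimodular[OF B(1) Lc(2,1) L'L]
      col_lattice_mult_unimodular[OF C(1) Rc RR'] a_int b_int neg
    by (auto simp: L_def L'_def R_def R'_def elementary_row_def elementary_col_def Fin_le_val_iff)
  have inj: "inj_on (\<lambda>j. fst (pivot j)) {..<Suc k}" "inj_on (\<lambda>j. snd (pivot j)) {..<Suc k}"
    using inv pp(6,7) rc unfolding invariant_def lessThan_Suc by auto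
  have piv: "fst (pivot j) < d \<and> snd (pivot j) < d \<and> Ns (Suc k) $$ pivot j \<noteq> 0 \<and>
      (\<forall>s<d. s \<noteq> snd (pivot j) \<longrightarrow> Ns (Suc k) $$ (fst (pivot j), s) = 0) \<and>
      (\<forall>s<d. s \<noteq> fst (pivot j) \<longrightarrow> Ns (Suc k) $$ (s, snd (pivot j)) = 0)" if "j < Suc k" for j
  proof (cases "j = k")
    case True
    thus ?thesis using pp(3-5) by (auto simp: rc entry)
  next
    case False
    hence j: "j < k" using that by simp
    obtain r' c' where rc': "pivot j = (r', c')" by (cases "pivot j")
    have ne: "r' \<noteq> r" "c' \<noteq> c" using pp(6,7)[OF j] rc' by auto
    have lt: "r' < d" "c' < d" using old(1,2)[OF j] rc' by auto
    have z: "Ns k $$ (r', s) = 0" if "s < d" "s \<noteq> c'" for s using old(4)[OF j that(1)] that rc' by auto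
    have z': "Ns k $$ (s, c') = 0" if "s < d" "s \<noteq> r'" for s using old(5)[OF j that(1)] that rc' by auto
    \<comment> \<open>The row of an earlier pivot vanishes in column \<open>c\<close>, so the row
      step does not touch it.\<close>
    have "a r' = 0" unfolding a_def using z[OF pp(5)] ne by simp
    thus ?thesis unfolding rc' fst_conv snd_conv
      using lt ne z z' old(3)[OF j] rc' pp(4) by (auto simp: entry)
  qed
  show ?thesis unfolding invariant_def
    using inj piv lats' Suc_eq B C Lc Rc invertible_mat_mult(1)[OF B(1) Lc(2) B(2) inv_L'(1)]
      invertible_mat_mult(1)[OF C(1) Rc(1) C(2) inv_R] by simp
qed

lemma invariant: "k \<le> d \<Longrightarrow> invariant k"
proof (induction k)
  case 0
  show ?case unfolding invariant_def
    using P_carrier P_inv Q_carrier Q_inv by (simp add: sa_state_0)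
qed (simp add: invariant_Suc)

end

section \<open>The monomial matrix after the last step\<close>

context sa_run
begin

lemma pivot_lt: "k < d \<Longrightarrow> fst (pivot k) < d" "k < d \<Longrightarrow> snd (pivot k) < d"
  using pivot_props(4,5)[OF invariant] by simp_all

text \<open>\<open>invariant d\<close> describes one elimination step more than the algorithm
  performs; this places the last pivot in the one remaining row and column.\<close>

lemma bij_betw_pivot:
  "bij_betw (\<lambda>k. fst (pivot k)) {..<d} {..<d}" "bij_betw (\<lambda>k. snd (pivot k)) {..<d} {..<d}"
proof -
  have "inj_on (\<lambda>k. fst (pivot k)) {..<d}" "inj_on (\<lambda>k. snd (pivot k)) {..<d}"
    using invariant[of d] unfolding invariant_def by simp_all
  thus "bij_betw (\<lambda>k. fst (pivot k)) {..<d} {..<d}" "bij_betw (\<lambda>k. snd (pivot k)) {..<d} {..<d}"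
    using pivot_lt endo_inj_surj[of "{..<d}" "\<lambda>k. fst (pivot k)"]
      endo_inj_surj[of "{..<d}" "\<lambda>k. snd (pivot k)"]
    by (auto simp: bij_betw_def image_subset_iff)
qed

text \<open>Every column holds exactly one pivot. The count below relies on this to recover the
  number of rescaled columns from a set of steps.\<close>

lemma card_pivots_in_first_columns:
  assumes "i \<le> d"
  shows "card {k. k < d \<and> snd (pivot k) < i} = i"
proof -
  let ?f = "\<lambda>k. snd (pivot k)"
  have "?f ` {k. k < d \<and> ?f k < i} = {..<i}"
  proof (intro equalityI subsetI)
    fix s assume s: "s \<in> {..<i}"
    hence "s \<in> ?f ` {..<d}" using assms bij_betw_pivot(2) by (simp add: bij_betw_def)
    thus "s \<in> ?f ` {k. k < d \<and> ?f k < i}" using s by auto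
  qed auto
  moreover have "inj_on ?f {k. k < d \<and> ?f k < i}"
    using bij_betw_pivot(2) unfolding bij_betw_def by (rule conjE) (auto elim: inj_on_subset)
  ultimately show ?thesis using card_image by fastforce
qed

text \<open>The first \<open>d - 1\<close> pivots clear their rows and columns, which leaves a
  single further position.\<close>

lemma Ns_last_nonzero_iff:
  assumes "r < d" "s < d"
  shows "Ns (d - 1) $$ (r, s) \<noteq> 0 \<longleftrightarrow> (r, s) \<in> pivot ` {..<d}"
proof
  have d: "d - 1 < d" using assms by simp
  note I = invariant[of "d - 1"]
  have I': "\<And>j. j < d - 1 \<Longrightarrow> Ns (d - 1) $$ pivot j \<noteq> 0"
    "\<And>j s. j < d - 1 \<Longrightarrow> s < d \<Longrightarrow> s \<noteq> snd (pivot j) \<Longrightarrow> Ns (d - 1) $$ (fst (pivot j), s) = 0"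
    "\<And>j r. j < d - 1 \<Longrightarrow> r < d \<Longrightarrow> r \<noteq> fst (pivot j) \<Longrightarrow> Ns (d - 1) $$ (r, snd (pivot j)) = 0"
    using I unfolding invariant_def by auto
  show "(r, s) \<in> pivot ` {..<d}" if N: "Ns (d - 1) $$ (r, s) \<noteq> 0"
  proof -
    obtain j where j: "j < d" "r = fst (pivot j)"
      using bij_betw_pivot(1) assms(1) unfolding bij_betw_def by blast
    obtain j' where j': "j' < d" "s = snd (pivot j')"
      using bij_betw_pivot(2) assms(2) unfolding bij_betw_def by blast
    have "s = snd (pivot j)" if "j < d - 1" using I'(2)[OF that assms(2)] N j by blast
    moreover have "r = fst (pivot j')" if "j' < d - 1" using I'(3)[OF that assms(1)] N j' by blast
    moreover have "j = j'" if "\<not> j < d - 1" "\<not> j' < d - 1" using that j j' by simp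
    ultimately have "pivot j = (r, s) \<or> pivot j' = (r, s)" using j j'
      by (cases "j < d - 1"; cases "j' < d - 1") (simp_all add: prod_eq_iff)
    thus ?thesis using j(1) j'(1) by force
  qed
  assume "(r, s) \<in> pivot ` {..<d}"
  then obtain j where j: "j < d" "pivot j = (r, s)" by auto
  show "Ns (d - 1) $$ (r, s) \<noteq> 0"
  proof (cases "j < d - 1")
    case False
    hence "j = d - 1" using j by simp
    thus ?thesis using pivot_props(3)[OF I d] j by simp
  qed (use I'(1)[of j] j in simp)
qed

text \<open>The remaining nonzero entry, which defines the last pivot, is what the pivot rule would
  choose in step \<open>d - 1\<close>.\<close>

lemma sa_pivots_eq:
  assumes "0 < d"
  shows "sa_pivots val d P Q = map pivot [0..<d]"
proof -
  let ?k = "d - 1"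
  have k: "?k < d" using assms by simp
  have "(THE p. p \<in> set (positions d) - set (map pivot [0..<?k]) \<and> Ns ?k $$ p \<noteq> 0) = pivot ?k"
  proof (rule the_equality)
    show "pivot ?k \<in> set (positions d) - set (map pivot [0..<?k]) \<and> Ns ?k $$ pivot ?k \<noteq> 0"
      using pivot_props(1,3)[OF invariant k] k
      unfolding set_positions unused_positions_def by auto
    fix p assume p: "p \<in> set (positions d) - set (map pivot [0..<?k]) \<and> Ns ?k $$ p \<noteq> 0"
    hence "p \<in> pivot ` {..<d}" using Ns_last_nonzero_iff[of "fst p" "snd p"]
      by (auto simp: set_positions)
    moreover have "{..<d} = insert ?k {0..<?k}" using k by auto
    ultimately show "p = pivot ?k" using p by auto
  qed
  moreover have "[0..<d] = [0..<?k] @ [?k]" using assms by (cases d) simp_all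
  ultimately show ?thesis
    unfolding sa_pivots_def Let_def split_def sa_state_pivots
    by (simp add: Ns_def Bs_def Cs_def)
qed

lemma sa_base_change_eq: "sa_base_change val d P Q k = Ns k"
  unfolding sa_base_change_def Ns_def Bs_def Cs_def by (simp add: Let_def split_def)

lemma sa_basis_eq: "sa_basis val d P Q = Bs (d - 1)"
  unfolding sa_basis_def Bs_def ..

lemma sa_basis_props:
  "sa_basis val d P Q \<in> carrier_mat d d" "invertible_mat (sa_basis val d P Q)"
  "col_lattice val P = lat (sa_basis val d P Q) (\<lambda>_. 0)"
  using invariant[of "d - 1"] unfolding invariant_def sa_basis_eq col_lattice_eq_lat[symmetric] by auto

text \<open>The last base-change matrix is monomial and carries the SA-basis to a basis of the
  lattice of \<open>Q\<close>, so its entries give the exponents \<open>e\<close>.\<close>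

lemma sa_basis_adapted: "\<exists>e. col_lattice val Q = lat (sa_basis val d P Q) e"
proof -
  let ?k = "d - 1"
  have I: "invariant ?k" by (rule invariant) simp
  note N = Ns_props[OF I]
  \<comment> \<open>\<open>\<rho> r\<close> is the step whose pivot lies in row \<open>r\<close>;
    \<open>\<sigma> r\<close> is then the column of that pivot.\<close>
  define \<rho> where "\<rho> = inv_into {..<d} (\<lambda>k. fst (pivot k))"
  define \<sigma> where "\<sigma> = (\<lambda>k. snd (pivot k)) \<circ> \<rho>"
  have \<rho>: "bij_betw \<rho> {..<d} {..<d}"
    unfolding \<rho>_def by (rule bij_betw_inv_into[OF bij_betw_pivot(1)])
  have \<sigma>: "bij_betw \<sigma> {..<d} {..<d}"
    unfolding \<sigma>_def by (rule bij_betw_trans[OF \<rho> bij_betw_pivot(2)])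
  have "(r, s) \<in> pivot ` {..<d} \<longleftrightarrow> s = \<sigma> r" if "r < d" for r s
  proof -
    have r: "\<rho> r < d" "fst (pivot (\<rho> r)) = r"
      using bij_betwE[OF \<rho>] that f_inv_into_f[of r "\<lambda>k. fst (pivot k)" "{..<d}"] bij_betw_pivot(1)
      unfolding \<rho>_def bij_betw_def by auto
    have p: "pivot (\<rho> r) = (r, \<sigma> r)" using r by (simp add: \<sigma>_def prod_eq_iff)
    have u: "j = \<rho> r" if "j < d" "fst (pivot j) = r" for j
      using bij_betw_pivot(1) that r unfolding bij_betw_def inj_on_def by auto
    show ?thesis
    proof
      assume "(r, s) \<in> pivot ` {..<d}"
      then obtain j where j: "j < d" "pivot j = (r, s)" by auto
      thus "s = \<sigma> r" using u[OF j(1)] p by simp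
    next
      assume "s = \<sigma> r"
      thus "(r, s) \<in> pivot ` {..<d}" using p r(1) by (metis image_eqI lessThan_iff)
    qed
  qed
  hence "lat (Bs ?k * Ns ?k) (\<lambda>_. 0) = lat (Bs ?k) (\<lambda>r. 0 + ord (Ns ?k $$ (r, \<sigma> r)))"
    using I N \<sigma> Ns_last_nonzero_iff by (intro lat_monomial_mult) (auto simp: invariant_def)
  moreover have "col_lattice val Q = lat (Bs ?k * Ns ?k) (\<lambda>_. 0)"
    using I N(3) unfolding invariant_def col_lattice_eq_lat[symmetric] by simp
  ultimately show ?thesis unfolding sa_basis_eq by metis
qed

end

section \<open>Rescaling the first columns\<close>

text \<open>The scaling multiplies the coefficient of column \<open>s\<close> by
  \<open>\<delta> s / \<delta> c\<close>, which amounts to conjugating the elimination matrix by the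
  diagonal one.\<close>

lemma col_elim_mult_diag:
  assumes "X \<in> carrier_mat d d" "r < d" "c < d" "\<And>s. s < d \<Longrightarrow> \<delta> s \<noteq> (0 :: 'b::field)"
  shows "mat_diag d \<delta> * col_elim d (X * mat_diag d \<delta>) (r, c) = col_elim d X (r, c) * mat_diag d \<delta>"
proof -
  have C: "col_elim d Y (r, c) \<in> carrier_mat d d" for Y :: "'b mat"
    unfolding col_elim_eq by simp
  show ?thesis
    unfolding mat_diag_mult_left[OF C] mat_diag_mult_right[OF C] mat_diag_mult_right[OF assms(1)]
    using assms by (intro eq_matI) (auto simp: col_elim_def)
qed

text \<open>Numerator and denominator of each multiplier lie in column \<open>c\<close>, so the
  scaling cancels.\<close>

lemma row_elim_mult_diag:
  assumes "X \<in> carrier_mat d d" "r < d" "c < d" "\<And>s. s < d \<Longrightarrow> \<delta> s \<noteq> (0 :: 'b::field)"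
  shows "row_elim d (X * mat_diag d \<delta>) (r, c) = row_elim d X (r, c)"
  unfolding mat_diag_mult_right[OF assms(1)]
  using assms by (intro eq_matI) (auto simp: row_elim_def)

context uniformized_valuation
begin

lemma sa_run_scale_columns:
  fixes \<delta> :: "nat \<Rightarrow> 'a"
  assumes "sa_run val \<pi> d P Q" and \<delta>: "\<And>s. s < d \<Longrightarrow> \<delta> s \<noteq> 0"
  shows "sa_run val \<pi> d P (Q * mat_diag d \<delta>)"
proof -
  interpret X: sa_run val \<pi> d P Q by fact
  show ?thesis
    using X.P_carrier X.P_inv X.Q_carrier X.Q_inv invertible_mat_diag[of d \<delta>] \<delta>
    by unfold_locales (auto intro!: invertible_mat_mult(1)[of _ d])
qed

text \<open>While the pivots agree, the row operations and hence \<open>Bs\<close> agree too, and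
  the diagonal factor passes through the column operations to the right.\<close>

lemma sa_state_scale_columns:
  fixes \<delta> :: "nat \<Rightarrow> 'a"
  assumes run: "sa_run val \<pi> d P Q" and \<delta>: "\<And>s. s < d \<Longrightarrow> \<delta> s \<noteq> 0"
    and piv: "\<And>j. j < k \<Longrightarrow> sa_run.pivot val d P (Q * mat_diag d \<delta>) j = sa_run.pivot val d P Q j"
    and k: "k \<le> d"
  shows "sa_run.Bs val d P (Q * mat_diag d \<delta>) k = sa_run.Bs val d P Q k"
    and "sa_run.Ns val d P (Q * mat_diag d \<delta>) k = sa_run.Ns val d P Q k * mat_diag d \<delta>"
proof -
  let ?D = "mat_diag d \<delta>"
  interpret X: sa_run val \<pi> d P Q by fact
  interpret Y: sa_run val \<pi> d P "Q * ?D" by (rule sa_run_scale_columns[OF run \<delta>])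
  have N: "Y.Ns j = X.Ns j * ?D" if "Y.Bs j = X.Bs j" "Y.Cs j = X.Cs j * ?D" "j \<le> d" for j
  proof -
    have "inv_mat (X.Bs j) \<in> carrier_mat d d" "X.Cs j \<in> carrier_mat d d"
      using X.invariant[OF that(3)] invertible_matD unfolding X.invariant_def by auto
    thus ?thesis unfolding X.Ns_def Y.Ns_def that
      by (intro assoc_mult_mat[symmetric, of _ d d _ d _ d]) auto
  qed
  have "Y.Bs k = X.Bs k \<and> Y.Cs k = X.Cs k * ?D" using piv k
  proof (induction k)
    case 0
    show ?case by (simp add: X.sa_state_0 Y.sa_state_0)
  next
    case (Suc k)
    hence IH: "Y.Bs k = X.Bs k" "Y.Cs k = X.Cs k * ?D" and k: "k < d" and p: "Y.pivot k = X.pivot k"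
      by auto
    obtain r c where rc: "X.pivot k = (r, c)" by (cases "X.pivot k")
    have rc_lt: "r < d" "c < d" using X.pivot_lt[OF k] rc by auto
    note I = X.invariant[OF less_imp_le[OF k]]
    have Nc: "X.Ns k \<in> carrier_mat d d" and Cc: "X.Cs k \<in> carrier_mat d d"
      using X.Ns_props(1)[OF I] I unfolding X.invariant_def by auto
    have Nk: "Y.Ns k = X.Ns k * ?D" using N IH k by simp
    have L: "row_elim d (Y.Ns k) (r, c) = row_elim d (X.Ns k) (r, c)"
      unfolding Nk by (rule row_elim_mult_diag[OF Nc rc_lt \<delta>])
    let ?L = "row_elim d (X.Ns k) (r, c)"
    let ?R = "col_elim d (?L * X.Ns k) (r, c)" and ?R' = "col_elim d (?L * X.Ns k * ?D) (r, c)"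
    have Lc: "?L \<in> carrier_mat d d" unfolding row_elim_eq by simp
    have Rc: "?R \<in> carrier_mat d d" "?R' \<in> carrier_mat d d" unfolding col_elim_eq by simp_all
    have LN: "?L * Y.Ns k = ?L * X.Ns k * ?D"
      unfolding Nk by (rule assoc_mult_mat[symmetric, OF Lc Nc mat_diag_dim])
    have "Y.Cs (Suc k) = X.Cs k * ?D * ?R'"
      unfolding Y.sa_state_Suc p rc L LN IH ..
    also have "\<dots> = X.Cs k * (?D * ?R')"
      by (rule assoc_mult_mat[OF Cc mat_diag_dim Rc(2)])
    also have "?D * ?R' = ?R * ?D"
      using Lc Nc rc_lt \<delta> by (intro col_elim_mult_diag) auto
    also have "X.Cs k * (?R * ?D) = X.Cs k * ?R * ?D"
      by (rule assoc_mult_mat[symmetric, OF Cc Rc(1) mat_diag_dim])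
    finally have "Y.Cs (Suc k) = X.Cs (Suc k) * ?D" unfolding X.sa_state_Suc rc .
    moreover have "Y.Bs (Suc k) = X.Bs (Suc k)"
      unfolding X.sa_state_Suc Y.sa_state_Suc p rc L IH ..
    ultimately show ?case by simp
  qed
  thus "Y.Bs k = X.Bs k" "Y.Ns k = X.Ns k * ?D" using N k by blast+
qed

text \<open>The factor between the targets for \<lambda> and \<lambda> + t when the first
  \<open>i\<close> exponents are at most \<lambda> and the others at least \<lambda> + t.\<close>

definition shift_diag :: "nat \<Rightarrow> nat \<Rightarrow> int \<Rightarrow> 'a mat" where
  "shift_diag d i t = mat_diag d (\<lambda>s. if s < i then \<pi> powi t else 1)"

lemma val_mult_shift_diag:
  assumes "N \<in> carrier_mat d d" "r < d" "s < d"
  shows "val ((N * shift_diag d i t) $$ (r, s)) = val (N $$ (r, s)) + (if s < i then Fin t else Fin 0)"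
proof (cases "N $$ (r, s) = 0")
  case True
  thus ?thesis using assms unfolding shift_diag_def mat_diag_mult_right[OF assms(1)] by simp
next
  case False
  thus ?thesis using assms unfolding shift_diag_def mat_diag_mult_right[OF assms(1)]
    by (auto simp: val_mult val_eq_Fin)
qed

lemma sa_run_shift:
  assumes "sa_run val \<pi> d P Q"
  shows "sa_run val \<pi> d P (Q * shift_diag d i t)"
  unfolding shift_diag_def by (rule sa_run_scale_columns[OF assms]) simp

text \<open>Reduces equality of SA-bases to one pivot comparison per step: agreement of the earlier
  pivots already relates the two base-change matrices.\<close>

lemma pivots_shift_eqI:
  assumes run: "sa_run val \<pi> d P Q"
    and step: "\<And>k. k < d \<Longrightarrow>
      sa_run.Ns val d P (Q * shift_diag d i t) k = sa_run.Ns val d P Q k * shift_diag d i t \<Longrightarrow>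
      (\<And>j. j < k \<Longrightarrow> sa_run.pivot val d P (Q * shift_diag d i t) j = sa_run.pivot val d P Q j) \<Longrightarrow>
      sa_run.pivot val d P (Q * shift_diag d i t) k = sa_run.pivot val d P Q k"
  shows "sa_basis val d P (Q * shift_diag d i t) = sa_basis val d P Q"
proof -
  interpret X: sa_run val \<pi> d P Q by fact
  interpret Y: sa_run val \<pi> d P "Q * shift_diag d i t" by (rule sa_run_shift[OF run])
  have piv: "k < d \<Longrightarrow> Y.pivot k = X.pivot k" for k
  proof (induction k rule: less_induct)
    case (less k)
    hence "Y.Ns k = X.Ns k * shift_diag d i t"
      unfolding shift_diag_def by (intro sa_state_scale_columns(2)[OF run]) auto
    thus ?case
      by (rule step[OF less.prems]) (rule less.IH[OF _ less_trans[OF _ less.prems]])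
  qed
  have "Y.Bs (d - 1) = X.Bs (d - 1)" unfolding shift_diag_def
    by (rule sa_state_scale_columns(1)[OF run]) (auto simp: piv[unfolded shift_diag_def])
  thus ?thesis using X.sa_basis_eq Y.sa_basis_eq by simp
qed

text \<open>Within the first \<open>i\<close> columns, and within the others, the shift does not affect the order of
  the candidates, so only the choice between the two groups matters.\<close>

lemma sa_basis_shift_eq_if_same_columns:
  assumes run: "sa_run val \<pi> d P Q"
    and same: "\<And>k. k < d \<Longrightarrow>
      snd (sa_run.pivot val d P (Q * shift_diag d i t) k) < i \<longleftrightarrow> snd (sa_run.pivot val d P Q k) < i"
  shows "sa_basis val d P (Q * shift_diag d i t) = sa_basis val d P Q"
proof -
  interpret X: sa_run val \<pi> d P Q by fact
  interpret Y: sa_run val \<pi> d P "Q * shift_diag d i t" by (rule sa_run_shift[OF run])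
  show ?thesis
  proof (rule pivots_shift_eqI[OF run])
    fix k assume k: "k < d" and N: "Y.Ns k = X.Ns k * shift_diag d i t"
      and old: "\<And>j. j < k \<Longrightarrow> Y.pivot j = X.pivot j"
    let ?U = "unused_positions d (X.pivot ` {..<k})"
    have U: "unused_positions d (Y.pivot ` {..<k}) = ?U" using old by simp
    note pX = X.pivot_props(1,2)[OF X.invariant[OF less_imp_le[OF k]] k]
    note pY = Y.pivot_props(1,2)[OF Y.invariant[OF less_imp_le[OF k]] k, unfolded U]
    have Nc: "X.Ns k \<in> carrier_mat d d" using X.Ns_props(1)[OF X.invariant] k by simp
    obtain r c where rc: "X.pivot k = (r, c)" by (cases "X.pivot k")
    obtain r' c' where rc': "Y.pivot k = (r', c')" by (cases "Y.pivot k")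
    have lt: "r < d" "c < d" "r' < d" "c' < d" using X.pivot_lt[OF k] Y.pivot_lt[OF k] rc rc' by auto
    \<comment> \<open>Both pivots lie in the same group of columns, so the shift changes both
      valuations equally and the comparison made after the shift also holds before it.\<close>
    have "c' < i \<longleftrightarrow> c < i" using same[OF k] rc rc' by simp
    moreover have "pivot_before val (X.Ns k * shift_diag d i t) (r', c') (r, c)"
      using pY(2)[OF pX(1)] unfolding N rc rc' .
    ultimately have "pivot_before val (X.Ns k) (r', c') (r, c)"
      unfolding pivot_before_def val_mult_shift_diag[OF Nc lt(1,2)] val_mult_shift_diag[OF Nc lt(3,4)]
      by (cases "X.Ns k $$ (r, c) = 0"; cases "X.Ns k $$ (r', c') = 0")
        (auto simp: val_eq_Fin split: if_splits)
    moreover have "pivot_before val (X.Ns k) (r, c) (r', c')"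
      using pX(2)[OF pY(1)] unfolding rc rc' .
    ultimately show "Y.pivot k = X.pivot k" unfolding rc rc' by (rule pivot_before_antisym)
  qed
qed

text \<open>As \<open>0 \<le> t\<close>, a shift only worsens the first \<open>i\<close> columns. A
  pivot there could be overtaken only from the other columns, which \<open>small\<close> excludes;
  equality is harmless because ties go to the leftmost column.\<close>

lemma sa_basis_shift_eq_if_small:
  assumes run: "sa_run val \<pi> d P Q" and t: "0 \<le> t"
    and small: "\<And>k r s. k < d \<Longrightarrow> snd (sa_run.pivot val d P Q k) < i \<Longrightarrow> r < d \<Longrightarrow> i \<le> s \<Longrightarrow> s < d \<Longrightarrow>
      (r, s) \<notin> sa_run.pivot val d P Q ` {..k} \<Longrightarrow>
      val (sa_run.Ns val d P Q k $$ sa_run.pivot val d P Q k) + Fin t \<le> val (sa_run.Ns val d P Q k $$ (r, s))"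
  shows "sa_basis val d P (Q * shift_diag d i t) = sa_basis val d P Q"
proof -
  interpret X: sa_run val \<pi> d P Q by fact
  interpret Y: sa_run val \<pi> d P "Q * shift_diag d i t" by (rule sa_run_shift[OF run])
  show ?thesis
  proof (rule pivots_shift_eqI[OF run])
    fix k assume k: "k < d" and N: "Y.Ns k = X.Ns k * shift_diag d i t"
      and old: "\<And>j. j < k \<Longrightarrow> Y.pivot j = X.pivot j"
    let ?U = "unused_positions d (X.pivot ` {..<k})"
    have set: "set (map Y.pivot [0..<k]) = X.pivot ` {..<k}" using old by (auto simp: image_iff)
    note pX = X.pivot_props(1,2,3)[OF X.invariant[OF less_imp_le[OF k]] k]
    have Nc: "X.Ns k \<in> carrier_mat d d" using X.Ns_props(1)[OF X.invariant] k by simp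
    obtain r c where rc: "X.pivot k = (r, c)" by (cases "X.pivot k")
    have lt: "r < d" "c < d" using X.pivot_lt[OF k] rc by auto
    have "pivot_before val (X.Ns k * shift_diag d i t) (X.pivot k) q" if q: "q \<in> ?U" for q
    proof (cases "q = X.pivot k")
      case False
      obtain r' c' where rc': "q = (r', c')" by (cases q)
      have lt': "r' < d" "c' < d" using q rc' unfolding unused_positions_def by auto
      have "q \<notin> X.pivot ` {..k}"
        using q False unfolding unused_positions_def by (auto simp: le_less)
      hence "val (X.Ns k $$ (r, c)) + Fin t \<le> val (X.Ns k $$ (r', c'))" if "c < i" "i \<le> c'"
        using small[OF k] that rc rc' lt' by auto
      moreover have "pivot_before val (X.Ns k) (r, c) (r', c')" using pX(2)[OF q] rc rc' by simp
      ultimately show ?thesis using pX(3) t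
        unfolding rc rc' pivot_before_def val_mult_shift_diag[OF Nc lt] val_mult_shift_diag[OF Nc lt']
        by (cases "X.Ns k $$ (r', c') = 0") (auto simp: val_eq_Fin pos_less_def not_less)
    qed (simp add: pivot_before_def)
    thus "Y.pivot k = X.pivot k"
      unfolding Y.pivot_eq[of k] N using pX(1) by (intro min_pivot_eqI) (simp_all only: set)
  qed
qed

end

section \<open>The convex-triangle algorithm\<close>

text \<open>The fold of \<open>step_width\<close> in the abstract: an update never raises
  \<open>t\<close>, so each contribution stays an upper bound, and a contribution with
  \<open>a \<le> b\<close> is at least 1.\<close>

lemma fold_min_bounds:
  fixes v w :: "nat \<Rightarrow> int extended" and t\<^sub>0 :: int and C :: "nat \<Rightarrow> bool"
  defines "F \<equiv> \<lambda>j t. if C j then (case (v j, w j) of (Fin a, Fin b) \<Rightarrow> min t (b - a + 1) | _ \<Rightarrow> t) else t"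
  shows "j \<in> set js \<Longrightarrow> C j \<Longrightarrow> v j = Fin a \<Longrightarrow> w j = Fin b \<Longrightarrow> fold F js t\<^sub>0 \<le> b - a + 1"
    and "(\<And>j a b. j \<in> set js \<Longrightarrow> C j \<Longrightarrow> v j = Fin a \<Longrightarrow> w j = Fin b \<Longrightarrow> a \<le> b) \<Longrightarrow> 1 \<le> t\<^sub>0 \<Longrightarrow>
      1 \<le> fold F js t\<^sub>0"
proof -
  have F_le: "F j t \<le> t" for j t
    unfolding F_def by (auto split: extended.split)
  have le: "fold F js t \<le> t" for js t
    by (induction js arbitrary: t) (auto intro: order_trans[OF _ F_le])
  show "fold F js t\<^sub>0 \<le> b - a + 1" if "j \<in> set js" "C j" "v j = Fin a" "w j = Fin b"
    using that(1)
  proof (induction js arbitrary: t\<^sub>0)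
    case (Cons k js)
    show ?case
    proof (cases "j = k")
      case True
      have "F j t\<^sub>0 \<le> b - a + 1" unfolding F_def using that by simp
      thus ?thesis using True le[of js "F j t\<^sub>0"] by simp
    qed (use Cons in simp)
  qed simp
  show "1 \<le> fold F js t\<^sub>0"
    if "\<And>j a b. j \<in> set js \<Longrightarrow> C j \<Longrightarrow> v j = Fin a \<Longrightarrow> w j = Fin b \<Longrightarrow> a \<le> b" "1 \<le> t\<^sub>0"
    using that
  proof (induction js arbitrary: t\<^sub>0)
    case (Cons k js)
    have "1 \<le> F k t\<^sub>0"
      using Cons.prems(1)[of k] Cons.prems(2) unfolding F_def by (auto split: extended.split)
    thus ?case using Cons.prems(1) by (auto intro!: Cons.IH)
  qed simp
qed

section \<open>The step width bounds the harmless shifts\<close>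

context sa_run
begin

text \<open>The number \<open>v\<^sub>2\<close> of the algorithm at step \<open>k\<close>;
  \<open>Pinf\<close> serves as the minimum when no position is left.\<close>

definition off_val :: "nat \<Rightarrow> nat \<Rightarrow> int extended" where
  "off_val i k = Min (insert Pinf {val (Ns k $$ (r, s)) | r s.
     r < d \<and> i \<le> s \<and> s < d \<and> (r, s) \<notin> pivot ` {..k}})"

lemma step_width_eq:
  "step_width val d P Q i t\<^sub>0 = fold (\<lambda>k t. if snd (pivot k) < i then
      (case (val (Ns k $$ pivot k), off_val i k) of (Fin a, Fin b) \<Rightarrow> min t (b - a + 1) | _ \<Rightarrow> t)
    else t) [0..<d] t\<^sub>0"
proof (cases "d = 0")
  case False
  have take: "set (take (Suc k) (map pivot [0..<d])) = pivot ` {..k}" if "k < d" for k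
    using that by (simp add: take_map atLeast0LessThan lessThan_Suc_atMost del: upt_Suc)
  show ?thesis
    using False unfolding step_width_def Let_def sa_base_change_eq
    by (intro fold_cong refl ext) (auto simp: sa_pivots_eq take off_val_def)
qed (simp add: step_width_def Let_def)

lemma off_val_set_finite:
  "finite {val (Ns k $$ (r, s)) | r s. r < d \<and> i \<le> s \<and> s < d \<and> (r, s) \<notin> pivot ` {..k}}"
proof (rule finite_subset)
  show "{val (Ns k $$ (r, s)) | r s. r < d \<and> i \<le> s \<and> s < d \<and> (r, s) \<notin> pivot ` {..k}}
      \<subseteq> (\<lambda>p. val (Ns k $$ p)) ` ({..<d} \<times> {..<d})" by auto
qed simp

lemma off_val_le:
  assumes "r < d" "i \<le> s" "s < d" "(r, s) \<notin> pivot ` {..k}"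
  shows "off_val i k \<le> val (Ns k $$ (r, s))"
  unfolding off_val_def using off_val_set_finite assms by (intro Min_le) auto

lemma off_val_cases:
  assumes "off_val i k = Fin b"
  obtains r s where "r < d" "s < d" "(r, s) \<notin> pivot ` {..k}" "val (Ns k $$ (r, s)) = Fin b"
proof -
  have "off_val i k \<in> insert Pinf {val (Ns k $$ (r, s)) | r s.
     r < d \<and> i \<le> s \<and> s < d \<and> (r, s) \<notin> pivot ` {..k}}"
    unfolding off_val_def using off_val_set_finite by (intro Min_in) auto
  thus ?thesis using assms that by auto
qed

lemma off_val_ge_pivot:
  assumes "k < d"
  shows "val (Ns k $$ pivot k) \<le> off_val i k"
proof (cases "off_val i k")
  case (Fin b)
  then obtain r s where rs: "r < d" "s < d" "(r, s) \<notin> pivot ` {..k}" "val (Ns k $$ (r, s)) = Fin b"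
    by (rule off_val_cases)
  hence "(r, s) \<in> unused_positions d (pivot ` {..<k})"
    unfolding unused_positions_def by auto
  hence "val (Ns k $$ pivot k) \<le> val (Ns k $$ (r, s))"
    using assms by (intro pivot_before_imp_le pivot_props(2) invariant) simp_all
  thus ?thesis using rs(4) Fin by simp
next
  case Minf
  have "off_val i k \<in> insert Pinf {val (Ns k $$ (r, s)) | r s.
     r < d \<and> i \<le> s \<and> s < d \<and> (r, s) \<notin> pivot ` {..k}}"
    unfolding off_val_def using off_val_set_finite by (intro Min_in) auto
  thus ?thesis using Minf val_not_Minf by auto metis
qed simp

text \<open>Here the \<open>+ 1\<close> in the update guarantees progress, on which termination of
  the loop rests.\<close>

lemma step_width_ge_1:
  assumes "1 \<le> t\<^sub>0"
  shows "1 \<le> step_width val d P Q i t\<^sub>0"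
  unfolding step_width_eq
proof (rule fold_min_bounds(2)[OF _ assms])
  fix k a b assume "k \<in> set [0..<d]" "val (Ns k $$ pivot k) = Fin a" "off_val i k = Fin b"
  thus "a \<le> b" using off_val_ge_pivot[of k i] by simp
qed

text \<open>Strictly below the width, \<open>t\<close> is at most
  \<open>v\<^sub>2 - v\<^sub>1\<close> for every pivot in the first \<open>i\<close> columns with
  finite \<open>v\<^sub>2\<close>.\<close>

lemma sa_basis_shift_eq_if_lt_step_width:
  assumes t: "0 \<le> t" "t < step_width val d P Q i t\<^sub>0"
  shows "sa_basis val d P (Q * shift_diag d i t) = sa_basis val d P Q"
proof (rule sa_basis_shift_eq_if_small[OF _ t(1)])
  show "sa_run val \<pi> d P Q" by (rule sa_run_axioms)
  fix k r s assume k: "k < d" "snd (pivot k) < i"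
    and rs: "r < d" "i \<le> s" "s < d" "(r, s) \<notin> pivot ` {..k}"
  note le = off_val_le[OF rs]
  show "val (Ns k $$ pivot k) + Fin t \<le> val (Ns k $$ (r, s))"
  proof (cases "Ns k $$ (r, s) = 0")
    case False
    have p: "val (Ns k $$ pivot k) = Fin (ord (Ns k $$ pivot k))"
      using pivot_props(3)[OF invariant k(1)] k(1) by (simp add: val_eq_Fin)
    \<comment> \<open>\<open>off_val\<close> lies between the valuations of the pivot and of a
      nonzero entry, so it is finite and enters the fold.\<close>
    obtain b where b: "off_val i k = Fin b"
      using le off_val_ge_pivot[OF k(1), of i] p val_eq_Fin[OF False]
      by (cases "off_val i k") auto
    have "step_width val d P Q i t\<^sub>0 \<le> b - ord (Ns k $$ pivot k) + 1"
      unfolding step_width_eq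
      by (rule fold_min_bounds(1)[where j = k]) (use k p b in simp_all)
    hence "Fin (ord (Ns k $$ pivot k) + t) \<le> Fin b" using t(2) by simp
    also have "Fin b \<le> val (Ns k $$ (r, s))" using le b by simp
    finally show ?thesis unfolding p by simp
  qed simp
qed

end


section \<open>The apartments for all integer parameters\<close>

locale convex_triangle_run = uniformized_valuation +
  fixes d :: nat and M A :: "'a mat" and c :: "nat \<Rightarrow> int"
  assumes M_carrier: "M \<in> carrier_mat d d" and M_inv: "invertible_mat M"
    and A_carrier: "A \<in> carrier_mat d d" and A_inv: "invertible_mat A"
    and c_mono: "i \<le> j \<Longrightarrow> j < d \<Longrightarrow> c i \<le> c j"
begin

abbreviation target :: "int \<Rightarrow> 'a mat" where
  "target l \<equiv> A * gamma_mat \<pi> d c l"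

definition basis :: "int \<Rightarrow> 'a mat" where
  "basis l = sa_basis val d M (target l)"

text \<open>Defined for every integer, so that the covering of the hull can be separated from the
  question which values the loops visit.\<close>

definition apt :: "int \<Rightarrow> 'a vec set set set" where
  "apt l = apartment val \<pi> d (basis l)"

lemma gamma_mat_carrier [simp]: "gamma_mat \<pi> d c l \<in> carrier_mat d d"
  unfolding gamma_mat_def by simp

lemma run: "sa_run val \<pi> d M (target l)"
  using M_carrier M_inv A_carrier A_inv
    invertible_mat_mult(1)[OF A_carrier gamma_mat_carrier A_inv, of l]
    invertible_mat_diag[of d "\<lambda>i. \<pi> powi max l (c i)"]
  by unfold_locales (auto simp: gamma_mat_def)

text \<open>Under these bounds \<open>max l' (c s) - max l (c s)\<close> is \<open>l' - l\<close>
  for \<open>s < i\<close> and 0 otherwise.\<close>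

lemma target_shift:
  assumes "l \<le> l'" "\<And>j. j < d \<Longrightarrow> j < i \<Longrightarrow> c j \<le> l" "\<And>j. j < d \<Longrightarrow> i \<le> j \<Longrightarrow> l' \<le> c j"
  shows "target l' = target l * shift_diag d i (l' - l)"
proof -
  have "gamma_mat \<pi> d c l' = gamma_mat \<pi> d c l * shift_diag d i (l' - l)"
    unfolding gamma_mat_def shift_diag_def mat_diag_diag
  proof (rule eq_matI, goal_cases)
    case (1 r s)
    have "\<pi> powi max l' (c s) = \<pi> powi max l (c s) * (if s < i then \<pi> powi (l' - l) else 1)" if "s < d"
    proof (cases "s < i")
      case True
      hence "max l' (c s) = max l (c s) + (l' - l)" using assms that by force
      thus ?thesis using True by (simp only: power_int_add[of \<pi>] uniformizer_neq_0 simp_thms if_True)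
    next
      case False
      hence "max l' (c s) = max l (c s)" using assms(1) assms(3)[of s] that by auto
      thus ?thesis using False by simp
    qed
    thus ?case using 1 by (simp add: mat_diag_def)
  qed (simp_all add: mat_diag_def)
  thus ?thesis
    using assoc_mult_mat[OF A_carrier gamma_mat_carrier, of "shift_diag d i (l' - l)" d l]
    by (simp add: shift_diag_def)
qed

lemma basis_eq_if_lt_step_width:
  assumes i: "i < d" "1 \<le> i" and l: "c (i - 1) \<le> l" "l \<le> l'" "l' \<le> c i"
    and t: "l' - l < step_width val d M (target l) i t\<^sub>0"
  shows "basis l' = basis l"
proof -
  have "target l' = target l * shift_diag d i (l' - l)"
  proof (rule target_shift[OF l(2)])
    show "c j \<le> l" if "j < d" "j < i" for j
      using that i by (intro order_trans[OF c_mono l(1)]) auto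
    show "l' \<le> c j" if "j < d" "i \<le> j" for j
      using that by (intro order_trans[OF l(3) c_mono]) auto
  qed
  thus ?thesis
    unfolding basis_def using sa_run.sa_basis_shift_eq_if_lt_step_width[OF run _ t] l by simp
qed

section \<open>Counting the apartments\<close>

text \<open>As \<open>c\<close> is increasing, these are the first \<open>active l\<close> columns,
  the ones rescaled when \<open>l\<close> is raised by one.\<close>

definition active :: "int \<Rightarrow> nat" where
  "active l = card {j. j < d \<and> c j \<le> l}"

lemma less_active_iff: "j < d \<Longrightarrow> j < active l \<longleftrightarrow> c j \<le> l"
proof -
  assume j: "j < d"
  have fin: "finite {j. j < d \<and> c j \<le> l}" by simp
  show ?thesis
  proof
    assume "c j \<le> l"
    hence "{..j} \<subseteq> {j. j < d \<and> c j \<le> l}" using c_mono[OF _ j] j by force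
    from card_mono[OF fin this] show "j < active l" unfolding active_def by simp
  next
    assume *: "j < active l"
    show "c j \<le> l"
    proof (rule ccontr)
      assume "\<not> c j \<le> l"
      hence "{j. j < d \<and> c j \<le> l} \<subseteq> {..<j}" using c_mono[of j] by (force simp: not_le)
      hence "active l \<le> j" unfolding active_def using card_mono[of "{..<j}"] by fastforce
      thus False using * by simp
    qed
  qed
qed

lemma active_le: "active l \<le> d"
  unfolding active_def using card_mono[of "{..<d}" "{j. j < d \<and> c j \<le> l}"] by auto

definition first_pivots :: "int \<Rightarrow> nat set" where
  "first_pivots l = {k. k < d \<and> snd (sa_run.pivot val d M (target l) k) < active l}"

lemma card_first_pivots: "card (first_pivots l) = active l"
  unfolding first_pivots_def by (rule sa_run.card_pivots_in_first_columns[OF run active_le])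

text \<open>Equal sets of steps have equal size, hence the same columns are active and the two
  targets differ by a shift of just these. The pivots of both runs then fall into the same group of
  columns at each step.\<close>

lemma basis_eq_if_first_pivots_eq:
  assumes "first_pivots l = first_pivots l'"
  shows "basis l = basis l'"
  using assms
proof (induction l l' rule: linorder_wlog)
  case (le l l')
  have act: "active l = active l'" using le card_first_pivots by metis
  have T: "target l' = target l * shift_diag d (active l) (l' - l)"
  proof (rule target_shift[OF le(1)])
    show "c j \<le> l" if "j < d" "j < active l" for j using less_active_iff that by blast
    show "l' \<le> c j" if "j < d" "active l \<le> j" for j using less_active_iff[of j l'] that act by simp
  qed
  have "sa_basis val d M (target l * shift_diag d (active l) (l' - l)) = sa_basis val d M (target l)"
  proof (rule sa_basis_shift_eq_if_same_columns[OF run])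
    fix k assume k: "k < d"
    have "k \<in> first_pivots l' \<longleftrightarrow> k \<in> first_pivots l" using le(2) by simp
    thus "snd (sa_run.pivot val d M (target l * shift_diag d (active l) (l' - l)) k) < active l
        \<longleftrightarrow> snd (sa_run.pivot val d M (target l) k) < active l"
      using k act unfolding T[symmetric] first_pivots_def by simp
  qed
  thus ?case unfolding basis_def T by simp
qed simp

text \<open>\<open>apt\<close> factors through \<open>first_pivots\<close>, whose values are subsets
  of \<open>{..<d}\<close>; \<open>g\<close> picks an arbitrary parameter for each set.\<close>

lemma card_range_apt: "finite (range apt)" "card (range apt) \<le> 2 ^ d"
proof -
  define g where "g W = apt (SOME l. first_pivots l = W)" for W
  have "apt l = g (first_pivots l)" for l
  proof -
    have "first_pivots (SOME l'. first_pivots l' = first_pivots l) = first_pivots l"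
      by (rule someI) simp
    thus ?thesis unfolding g_def apt_def using basis_eq_if_first_pivots_eq by metis
  qed
  moreover have "first_pivots l \<in> Pow {..<d}" for l unfolding first_pivots_def by auto
  ultimately have sub: "range apt \<subseteq> g ` Pow {..<d}" by blast
  show "finite (range apt)" using sub by (rule finite_subset) simp
  have "card (range apt) \<le> card (g ` Pow {..<d})" using sub by (intro card_mono) simp_all
  also have "\<dots> \<le> card (Pow {..<d})" by (rule card_image_le) simp
  finally show "card (range apt) \<le> 2 ^ d" by (simp add: card_Pow)
qed

lemma range_apt_subset: "range apt \<subseteq> apartments val \<pi> d"
  unfolding apartments_def apt_def basis_def using sa_run.sa_basis_props(1,2)[OF run] by auto

lemma apt_eq_below:
  assumes "\<And>j. j < d \<Longrightarrow> l \<le> c j" "\<And>j. j < d \<Longrightarrow> l' \<le> c j"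
  shows "apt l = apt l'"
proof -
  have "gamma_mat \<pi> d c l = gamma_mat \<pi> d c l'"
    using assms unfolding gamma_mat_def mat_diag_def by (intro eq_matI) (auto simp: max_def dest: order_antisym)
  thus ?thesis unfolding apt_def basis_def by simp
qed

text \<open>Once all columns are active, every step has its pivot in an active column, so both sets
  of steps are \<open>{..<d}\<close>.\<close>

lemma apt_eq_above:
  assumes "\<And>j. j < d \<Longrightarrow> c j \<le> l" "\<And>j. j < d \<Longrightarrow> c j \<le> l'"
  shows "apt l = apt l'"
proof -
  have "first_pivots m = {..<d}" if "\<And>j. j < d \<Longrightarrow> c j \<le> m" for m
  proof -
    have "{j. j < d \<and> c j \<le> m} = {..<d}" using that by auto
    hence "card (first_pivots m) = card {..<d}" unfolding card_first_pivots active_def by simp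
    thus ?thesis by (intro card_subset_eq) (auto simp: first_pivots_def)
  qed
  thus ?thesis unfolding apt_def using basis_eq_if_first_pivots_eq[of l l'] assms by metis
qed

section \<open>The values visited by the loops\<close>

text \<open>A loop may jump past \<open>c i\<close>, so at the upper end only some visited value at
  or beyond \<open>c i\<close> is recorded.\<close>

definition covers_step :: "nat \<Rightarrow> 'a vec set set set set \<Rightarrow> bool" where
  "covers_step i L \<longleftrightarrow> (\<forall>m. c (i - 1) \<le> m \<and> m < c i \<longrightarrow> apt m \<in> L) \<and>
     (c (i - 1) < c i \<longrightarrow> (\<exists>l\<ge>c i. apt l \<in> L))"

lemma covers_step_mono: "covers_step i L \<Longrightarrow> L \<subseteq> L' \<Longrightarrow> covers_step i L'"
  unfolding covers_step_def by blast

text \<open>The values skipped by one increment have the same SA-basis as the value before the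
  jump.\<close>

lemma triangle_loop_covers:
  assumes i: "i < d" "1 \<le> i"
  shows "\<exists>L. triangle_loop val \<pi> d M A c i L\<^sub>0 = Some L \<and> L\<^sub>0 \<subseteq> L \<and> L \<subseteq> L\<^sub>0 \<union> range apt \<and> covers_step i L"
proof -
  define b where "b = (\<lambda>(l :: int, t :: int, L :: 'a vec set set set set). l < c i)"
  define step where "step = (\<lambda>(l, t, L). let l' = l + t; Q = target l'
    in (l', step_width val d M Q i (c i - c (i - 1)),
        insert (apartment val \<pi> d (sa_basis val d M Q)) L))"
  \<comment> \<open>Here \<open>t\<close> is the increment still to be applied: everything below
    \<open>l + t\<close> is already represented. Only the initial state has
    \<open>t = 0\<close>.\<close>
  define I where "I = (\<lambda>(l, t, L). L\<^sub>0 \<subseteq> L \<and> L \<subseteq> L\<^sub>0 \<union> range apt \<and> c (i - 1) \<le> l \<and>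
    (t = 0 \<and> l = c (i - 1) \<or> 1 \<le> t \<and> apt l \<in> L) \<and>
    (\<forall>m. c (i - 1) \<le> m \<and> m < l + t \<and> m < c i \<longrightarrow> apt m \<in> L))"
  \<comment> \<open>The first iteration leaves \<open>l\<close> in place and is paid for by the
    extra 1; each later one raises \<open>l\<close>.\<close>
  define f where "f = (\<lambda>(l :: int, t :: int, L :: 'a vec set set set set).
    nat (2 * (c i - l) + (if t = 0 then 1 else 0)))"
  have preserve: "I (step s) \<and> f (step s) < f s" if I: "I s" and b: "b s" for s
  proof -
    obtain l t L where s: "s = (l, t, L)" by (cases s)
    have l: "l < c i" using b unfolding b_def s by simp
    have H: "L\<^sub>0 \<subseteq> L" "L \<subseteq> L\<^sub>0 \<union> range apt" "c (i - 1) \<le> l" "0 \<le> t"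
      "\<And>m. c (i - 1) \<le> m \<Longrightarrow> m < l + t \<Longrightarrow> m < c i \<Longrightarrow> apt m \<in> L"
      using I unfolding I_def s by auto
    define t' where "t' = step_width val d M (target (l + t)) i (c i - c (i - 1))"
    have step_s: "step s = (l + t, t', insert (apt (l + t)) L)"
      unfolding step_def s t'_def apt_def basis_def by (simp add: Let_def)
    \<comment> \<open>The initial value \<open>c i - c (i - 1)\<close> is positive because
      \<open>c (i - 1) \<le> l < c i\<close>.\<close>
    have t': "1 \<le> t'"
      unfolding t'_def using l H(3) by (intro sa_run.step_width_ge_1[OF run]) simp
    have same: "apt m = apt (l + t)" if "l + t \<le> m" "m < l + t + t'" "m < c i" for m
      unfolding apt_def using that H(3,4) basis_eq_if_lt_step_width[OF i, of "l + t" m "c i - c (i - 1)"]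
      unfolding t'_def by simp
    have "apt m \<in> insert (apt (l + t)) L"
      if "c (i - 1) \<le> m" "m < l + t + t'" "m < c i" for m
      using that H(5)[of m] same[of m] by (cases "m < l + t") simp_all
    hence "I (step s)" unfolding step_s unfolding I_def using H t' by auto
    moreover have "f (step s) < f s" unfolding step_s unfolding f_def s using l t' H(4) by auto
    ultimately show ?thesis ..
  qed
  have I0: "I (c (i - 1), 0, L\<^sub>0)" unfolding I_def by auto
  obtain s where s: "while_option b step (c (i - 1), 0, L\<^sub>0) = Some s"
    using measure_while_option_Some[of I b step f, OF preserve I0] by blast
  obtain l t L where slt: "s = (l, t, L)" by (cases s)
  have "I s" by (rule while_option_rule[of I b step, OF _ s I0]) (use preserve in blast)
  moreover have "\<not> l < c i" using while_option_stop[OF s] unfolding b_def slt by simp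
  ultimately have "L\<^sub>0 \<subseteq> L \<and> L \<subseteq> L\<^sub>0 \<union> range apt \<and> covers_step i L"
    unfolding I_def slt covers_step_def by auto
  moreover have "triangle_loop val \<pi> d M A c i L\<^sub>0 = Some L"
    using s unfolding triangle_loop_def b_def step_def slt by simp
  ultimately show ?thesis by blast
qed

lemma convex_triangle_covers_steps:
  "\<exists>L. convex_triangle val \<pi> d M A c = Some L \<and> L \<subseteq> range apt \<and> (\<forall>i. 1 \<le> i \<and> i < d \<longrightarrow> covers_step i L)"
proof -
  have "n \<le> d \<Longrightarrow> \<exists>L. fold (\<lambda>i res. Option.bind res (triangle_loop val \<pi> d M A c i)) [1..<n] (Some {}) = Some L \<and>
      L \<subseteq> range apt \<and> (\<forall>i. 1 \<le> i \<and> i < n \<longrightarrow> covers_step i L)" for n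
  proof (induction n)
    case (Suc n)
    then obtain L where L: "fold (\<lambda>i res. Option.bind res (triangle_loop val \<pi> d M A c i)) [1..<n] (Some {}) = Some L"
      "L \<subseteq> range apt" "\<And>i. 1 \<le> i \<Longrightarrow> i < n \<Longrightarrow> covers_step i L" by auto
    show ?case
    proof (cases "n = 0")
      case False
      obtain L' where L': "triangle_loop val \<pi> d M A c n L = Some L'" "L \<subseteq> L'" "L' \<subseteq> L \<union> range apt"
        "covers_step n L'"
        using triangle_loop_covers[of n L] Suc.prems False by auto
      have "covers_step i L'" if "1 \<le> i" "i < Suc n" for i
        using that L(3)[of i] L'(2,4) covers_step_mono[of i L L'] by (cases "i = n") auto
      moreover have "[1..<Suc n] = [1..<n] @ [n]" using False by simp
      ultimately show ?thesis using L L' by (auto intro!: exI[of _ L'])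
    qed simp
  qed simp
  thus ?thesis unfolding convex_triangle_def by blast
qed

text \<open>The half-open intervals from \<open>c (i - 1)\<close> to \<open>c i\<close> exhaust the
  range from the least to the greatest exponent, and outside it \<open>apt\<close> is constant on
  each side.\<close>

lemma convex_triangle_covers_all:
  assumes "c 0 < c (d - 1)"
  shows "\<exists>L. convex_triangle val \<pi> d M A c = Some L \<and> L = range apt"
proof -
  obtain L where L: "convex_triangle val \<pi> d M A c = Some L" "L \<subseteq> range apt"
    "\<And>i. 1 \<le> i \<Longrightarrow> i < d \<Longrightarrow> covers_step i L"
    using convex_triangle_covers_steps by blast
  \<comment> \<open>For \<open>d \<le> 1\<close> both indices in the assumption are 0.\<close>
  have d: "1 < d" using assms by (cases "1 < d") (auto simp: not_less le_Suc_eq)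
  have mid: "apt m \<in> L" if "c 0 \<le> m" "m < c (d - 1)" for m
  proof -
    define i where "i = (LEAST i. m < c i)"
    have i: "m < c i" unfolding i_def using that(2) by (rule LeastI)
    have "i \<le> d - 1" unfolding i_def using that(2) by (rule Least_le)
    moreover have "1 \<le> i" using i that(1) by (cases i) auto
    moreover have "\<not> m < c (i - 1)"
      using not_less_Least[of "i - 1" "\<lambda>i. m < c i"] \<open>1 \<le> i\<close> unfolding i_def[symmetric] by simp
    ultimately show ?thesis using L(3)[of i] i d unfolding covers_step_def by auto
  qed
  have top: "apt (c (d - 1)) \<in> L"
  proof -
    \<comment> \<open>The first index with the top exponent: its loop starts strictly below that
      value, so it runs and ends at or beyond it, where \<open>apt\<close> is constant.\<close>
    define i where "i = (LEAST i. c (d - 1) \<le> c i)"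
    have i: "c (d - 1) \<le> c i" unfolding i_def by (rule LeastI[of _ "d - 1"]) simp
    have i_le: "i \<le> d - 1" unfolding i_def by (rule Least_le) simp
    have i_ge: "1 \<le> i" using i assms by (cases i) auto
    hence "c (i - 1) < c (d - 1)"
      using not_less_Least[of "i - 1" "\<lambda>i. c (d - 1) \<le> c i"] unfolding i_def[symmetric] by simp
    hence "\<exists>l\<ge>c i. apt l \<in> L"
      using L(3)[OF i_ge] i_le i d unfolding covers_step_def by auto
    then obtain l where l: "c (d - 1) \<le> l" "apt l \<in> L" using i by (meson order_trans)
    have "c j \<le> c (d - 1)" if "j < d" for j using c_mono[of j "d - 1"] that by simp
    hence "apt (c (d - 1)) = apt l" using l by (intro apt_eq_above) force+
    thus ?thesis using l by simp
  qed
  have "apt m \<in> L" for m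
  proof -
    consider "m < c 0" | "c 0 \<le> m" "m < c (d - 1)" | "c (d - 1) \<le> m" by linarith
    thus "apt m \<in> L"
    proof cases
      case 1
      have "c 0 \<le> c j" if "j < d" for j using c_mono[of 0 j] that by simp
      hence "apt m = apt (c 0)" using 1 by (intro apt_eq_below) force+
      thus ?thesis using mid assms by simp
    next
      case 3
      have "c j \<le> c (d - 1)" if "j < d" for j using c_mono[of j "d - 1"] that by simp
      hence "apt m = apt (c (d - 1))" using 3 by (intro apt_eq_above) force+
      thus ?thesis using top by simp
    qed (rule mid)
  qed
  thus ?thesis using L by blast
qed

end

section \<open>The convex hull of three lattice classes\<close>

lemma smult_vec_image_inverse:
  assumes "a \<noteq> (0 :: 'b::field)"
  shows "(\<lambda>v. inverse a \<cdot>\<^sub>v v) ` (\<lambda>v. a \<cdot>\<^sub>v v) ` S = S"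
  using assms by (simp add: image_image smult_smult_assoc)

lemma lat_class_smult:
  assumes "a \<noteq> (0 :: 'b::field)"
  shows "lat_class ((\<lambda>v. a \<cdot>\<^sub>v v) ` S) = lat_class S"
proof -
  have sub: "lat_class ((\<lambda>v. a \<cdot>\<^sub>v v) ` S) \<subseteq> lat_class S" if "a \<noteq> 0" for a :: 'b and S
  proof
    fix X assume "X \<in> lat_class ((\<lambda>v. a \<cdot>\<^sub>v v) ` S)"
    then obtain b where "b \<noteq> 0" "X = (\<lambda>v. b \<cdot>\<^sub>v v) ` (\<lambda>v. a \<cdot>\<^sub>v v) ` S"
      unfolding lat_class_def by auto
    hence "b * a \<noteq> 0" "X = (\<lambda>v. (b * a) \<cdot>\<^sub>v v) ` S"
      using that by (simp_all add: image_image smult_smult_assoc)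
    thus "X \<in> lat_class S" unfolding lat_class_def by blast
  qed
  show ?thesis
    using sub[OF assms, of S] sub[of "inverse a" "(\<lambda>v. a \<cdot>\<^sub>v v) ` S"]
      smult_vec_image_inverse[OF assms] assms by auto
qed

lemma smult_vec_image_Int:
  assumes "a \<noteq> (0 :: 'b::field)"
  shows "(\<lambda>v. a \<cdot>\<^sub>v v) ` (S \<inter> T) = (\<lambda>v. a \<cdot>\<^sub>v v) ` S \<inter> (\<lambda>v. a \<cdot>\<^sub>v v) ` T"
proof (rule image_Int)
  show "inj (\<lambda>v. a \<cdot>\<^sub>v v)"
    by (rule inj_on_inverseI[where g = "\<lambda>v. inverse a \<cdot>\<^sub>v v"]) (use assms in \<open>simp add: smult_smult_assoc\<close>)
qed

lemma bounded_above_initial: "\<exists>K::int. \<forall>j<d::nat. g j \<le> K"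
proof (induction d)
  case (Suc d)
  then obtain K where "\<forall>j<d. g j \<le> K" by blast
  hence "\<forall>j<Suc d. g j \<le> max K (g d)" by (auto simp: less_Suc_eq le_max_iff_disj)
  thus ?case by blast
qed simp

lemma exists_sorting_permutation:
  fixes e :: "nat \<Rightarrow> int"
  shows "\<exists>\<sigma>. bij_betw \<sigma> {..<d} {..<d} \<and> (\<forall>i j. i \<le> j \<and> j < d \<longrightarrow> e (\<sigma> i) \<le> e (\<sigma> j))"
proof -
  let ?xs = "sort_key e [0..<d]"
  have "bij_betw ((!) ?xs) {..<d} {..<d}"
    by (rule bij_betw_nth) (auto simp: atLeast0LessThan)
  moreover have "e (?xs ! i) \<le> e (?xs ! j)" if "i \<le> j" "j < d" for i j
    using sorted_nth_mono[OF sorted_sort_key[of e "[0..<d]"] that(1)] that by simp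
  ultimately show ?thesis by blast
qed

section \<open>Scaling of classes and existence of an adapted basis\<close>

context uniformized_valuation
begin

lemma lat_class_lat_const:
  assumes "\<And>j. j < dim_col B \<Longrightarrow> e j = f j + n"
  shows "lat_class (lat B e) = lat_class (lat B f)"
proof -
  have "lat B e = lat B (\<lambda>j. f j + ord (\<pi> powi n))" using assms by (intro lat_cong) simp
  also have "\<dots> = (\<lambda>v. \<pi> powi n \<cdot>\<^sub>v v) ` lat B f"
    by (rule smult_lat[symmetric]) simp
  finally show ?thesis using lat_class_smult[of "\<pi> powi n" "lat B f"] by simp
qed

lemma lat_shift_cong:
  assumes "lat B e = lat C f"
  shows "lat B (\<lambda>j. e j + n) = lat C (\<lambda>j. f j + n)"
  using arg_cong[OF assms, of "\<lambda>S. (\<lambda>v. \<pi> powi n \<cdot>\<^sub>v v) ` S"] by (simp add: smult_lat)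

lemma lat_is_lattice:
  assumes "B \<in> carrier_mat d d" "invertible_mat B"
  shows "is_lattice val d (lat B e)"
proof -
  let ?D = "mat_diag d (\<lambda>i. \<pi> powi e i)"
  have "B * ?D \<in> carrier_mat d d" using assms by (intro mult_carrier_mat) auto
  moreover have "invertible_mat (B * ?D)"
    using assms by (intro invertible_mat_mult(1)[of _ d] invertible_mat_diag) auto
  ultimately show ?thesis
    unfolding is_lattice_def col_lattice_diag[OF assms(1), symmetric] by blast
qed

text \<open>The columns of the SA-basis for \<open>(P, Q)\<close> only have to be reordered so that
  the exponents increase.\<close>

lemma adapted_basis_exists:
  assumes P: "P \<in> carrier_mat d d" "invertible_mat P" and Q: "Q \<in> carrier_mat d d" "invertible_mat Q"
  shows "\<exists>A c. adapted_basis val \<pi> d P Q A c"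
proof -
  interpret sa_run val \<pi> d P Q by unfold_locales fact+
  let ?B = "sa_basis val d P Q"
  note B = sa_basis_props
  obtain e where e: "col_lattice val Q = lat ?B e" using sa_basis_adapted by blast
  obtain \<sigma> where \<sigma>: "bij_betw \<sigma> {..<d} {..<d}" "\<And>i j. i \<le> j \<Longrightarrow> j < d \<Longrightarrow> e (\<sigma> i) \<le> e (\<sigma> j)"
    using exists_sorting_permutation[of d e] by blast
  define \<tau> where "\<tau> = inv_into {..<d} \<sigma>"
  have \<tau>: "bij_betw \<tau> {..<d} {..<d}" unfolding \<tau>_def by (rule bij_betw_inv_into[OF \<sigma>(1)])
  have \<sigma>_lt: "\<sigma> i < d" if "i < d" for i using bij_betwE[OF \<sigma>(1)] that by simp
  have \<sigma>\<tau>: "\<sigma> (\<tau> r) = r" if "r < d" for r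
    using f_inv_into_f[of r \<sigma> "{..<d}"] \<sigma>(1) that unfolding \<tau>_def bij_betw_def by auto
  have \<tau>\<sigma>: "\<tau> (\<sigma> i) = i" if "i < d" for i
    using inv_into_f_f[of \<sigma> "{..<d}" i] \<sigma>(1) that unfolding \<tau>_def bij_betw_def by auto
  \<comment> \<open>The permutation matrix that moves column \<open>\<sigma> s\<close> of the
    SA-basis to place \<open>s\<close>; \<open>N'\<close> is its transpose.\<close>
  define N where "N = (mat d d (\<lambda>(r, s). if s = \<tau> r then 1 else 0) :: 'a mat)"
  define N' where "N' = (mat d d (\<lambda>(s, r). if s = \<tau> r then 1 else 0) :: 'a mat)"
  have Nc: "N \<in> carrier_mat d d" "N' \<in> carrier_mat d d" unfolding N_def N'_def by auto
  have "N * N' = 1\<^sub>m d"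
  proof (rule eq_matI)
    fix i j assume "i < dim_row (1\<^sub>m d :: 'a mat)" "j < dim_col (1\<^sub>m d :: 'a mat)"
    hence ij: "i < d" "j < d" by simp_all
    have "(N * N') $$ (i, j) = (\<Sum>s = 0..<d. (if s = \<tau> i then 1 else 0) * (if s = \<tau> j then 1 else 0))"
      using ij by (simp add: N_def N'_def scalar_prod_def)
    also have "\<dots> = (\<Sum>s = 0..<d. if s = \<tau> i then (if \<tau> i = \<tau> j then 1 else 0) else 0)"
      by (rule sum.cong) auto
    also have "\<dots> = (if \<tau> i = \<tau> j then 1 else 0)" using bij_betwE[OF \<tau>] ij by auto
    also have "\<tau> i = \<tau> j \<longleftrightarrow> i = j" using \<sigma>\<tau> ij by metis
    finally show "(N * N') $$ (i, j) = 1\<^sub>m d $$ (i, j)" using ij by simp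
  qed (use Nc in auto)
  hence N_inv: "invertible_mat N" by (rule invertible_matI[OF Nc])
  have BN: "?B * N \<in> carrier_mat d d" using B Nc by simp
  have lat_BN: "lat (?B * N) g = lat ?B (\<lambda>r. g (\<tau> r))" for g
  proof -
    have "lat (?B * N) g = lat ?B (\<lambda>r. g (\<tau> r) + ord (N $$ (r, \<tau> r)))"
      by (rule lat_monomial_mult[OF B(1) Nc(1) \<tau>]) (simp add: N_def)
    also have "\<dots> = lat ?B (\<lambda>r. g (\<tau> r))"
      using B(1) bij_betwE[OF \<tau>] by (intro lat_cong) (auto simp: N_def)
    finally show ?thesis .
  qed
  have "lat (?B * N) (\<lambda>i. e (\<sigma> i)) = col_lattice val Q"
    unfolding lat_BN e using B(1) \<sigma>\<tau> by (intro lat_cong) simp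
  moreover have "col_lattice val (?B * N) = col_lattice val P"
    unfolding col_lattice_eq_lat[of "?B * N"] lat_BN B(3) ..
  moreover have "invertible_mat (?B * N)" by (rule invertible_mat_mult(1)[OF B(1) Nc(1) B(2) N_inv])
  ultimately have "adapted_basis val \<pi> d P Q (?B * N) (\<lambda>i. e (\<sigma> i))"
    unfolding adapted_basis_def col_lattice_diag[OF BN] using BN \<sigma>(2) by blast
  thus ?thesis by blast
qed

end

section \<open>The hull as a set of threefold intersections\<close>

context convex_triangle_run
begin

lemma basis_props:
  "basis m \<in> carrier_mat d d" "invertible_mat (basis m)" "lat M (\<lambda>_. 0) = lat (basis m) (\<lambda>_. 0)"
  using sa_run.sa_basis_props[OF run, of m] unfolding basis_def col_lattice_eq_lat by simp_all

lemma basis_adapted: "\<exists>f. lat A (\<lambda>j. max m (c j)) = lat (basis m) f"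
proof -
  have "col_lattice val (target m) = lat A (\<lambda>j. max m (c j))"
    unfolding gamma_mat_def by (rule col_lattice_diag[OF A_carrier])
  thus ?thesis using sa_run.sa_basis_adapted[OF run, of m] unfolding basis_def by metis
qed

text \<open>One scaled copy of each of the three lattices. The two that are diagonal in
  \<open>A\<close> are bracketed because their intersection is a scaled target lattice.\<close>

definition triple :: "int \<Rightarrow> int \<Rightarrow> int \<Rightarrow> 'a vec set" where
  "triple a b e = lat M (\<lambda>_. a) \<inter> (lat A (\<lambda>_. b) \<inter> lat A (\<lambda>j. c j + e))"

text \<open>Factoring out \<open>\<pi> powi e\<close> shows which parameter is responsible:
  \<open>b - e\<close>.\<close>

lemma Int_targets:
  "lat A (\<lambda>_. b) \<inter> lat A (\<lambda>j. c j + e) = lat A (\<lambda>j. max (b - e) (c j) + e)"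
  unfolding lat_Int[OF A_carrier A_inv] by (intro lat_cong) auto

text \<open>The exponents \<open>f\<close> are chosen before \<open>a\<close>, so that
  \<open>a\<close> may later be chosen in terms of \<open>f\<close>.\<close>

lemma triple_in_basis:
  "\<exists>f. \<forall>a. lat M (\<lambda>_. a) = lat (basis (b - e)) (\<lambda>_. a) \<and>
    lat A (\<lambda>_. b) \<inter> lat A (\<lambda>j. c j + e) = lat (basis (b - e)) f"
proof -
  obtain f where f: "lat A (\<lambda>j. max (b - e) (c j)) = lat (basis (b - e)) f"
    using basis_adapted by blast
  have "lat M (\<lambda>_. a) = lat (basis (b - e)) (\<lambda>_. a)" for a
    using lat_shift_cong[OF basis_props(3), of a] by simp
  moreover have "lat A (\<lambda>_. b) \<inter> lat A (\<lambda>j. c j + e) = lat (basis (b - e)) (\<lambda>j. f j + e)"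
    unfolding Int_targets by (rule lat_shift_cong[OF f])
  ultimately show ?thesis by blast
qed

lemma triple_eq_lat: "\<exists>f. triple a b e = lat (basis (b - e)) f"
  using triple_in_basis[of b e] lat_Int[OF basis_props(1,2)] unfolding triple_def by metis

lemma lat_class_triple_in_apt: "lat_class (triple a b e) \<in> apt (b - e)"
proof -
  obtain f where "triple a b e = lat (basis (b - e)) f" using triple_eq_lat by blast
  thus ?thesis unfolding apt_def apartment_def col_lattice_diag[OF basis_props(1)] by auto
qed

lemma triple_Int:
  "triple a b e \<inter> triple a' b' e' = triple (max a a') (max b b') (max e e')"
proof -
  have "triple a b e \<inter> triple a' b' e' = (lat M (\<lambda>_. a) \<inter> lat M (\<lambda>_. a')) \<inter>
      ((lat A (\<lambda>_. b) \<inter> lat A (\<lambda>_. b')) \<inter> (lat A (\<lambda>j. c j + e) \<inter> lat A (\<lambda>j. c j + e')))"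
    unfolding triple_def by blast
  also have "\<dots> = triple (max a a') (max b b') (max e e')"
    unfolding triple_def lat_Int[OF A_carrier A_inv] lat_Int[OF M_carrier M_inv]
    by (simp add: max_add_distrib_right)
  finally show ?thesis .
qed

lemma smult_triple:
  assumes "x \<noteq> 0"
  shows "(\<lambda>v. x \<cdot>\<^sub>v v) ` triple a b e = triple (a + ord x) (b + ord x) (e + ord x)"
  unfolding triple_def smult_vec_image_Int[OF assms] smult_lat[OF assms] by (simp add: add.assoc)

text \<open>Each lattice lies in sufficiently enlarged copies of the other two, so intersecting with
  these changes nothing.\<close>

lemma triple_generators:
  shows "\<exists>a b e. lat M (\<lambda>_. 0) = triple a b e"
    and "\<exists>a b e. lat A (\<lambda>_. 0) = triple a b e"
    and "\<exists>a b e. lat A c = triple a b e"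
proof -
  \<comment> \<open>In a common basis the exponents of the intersection are at least
    \<open>- K\<close>, and those of the first lattice scaled by \<open>\<pi> powi (- K)\<close> are
    all equal to \<open>- K\<close>.\<close>
  have M_sub: "\<exists>a. lat A (\<lambda>_. b) \<inter> lat A (\<lambda>j. c j + e) \<subseteq> lat M (\<lambda>_. a)" for b e
  proof -
    obtain f where f: "\<And>a. lat M (\<lambda>_. a) = lat (basis (b - e)) (\<lambda>_. a)"
      "lat A (\<lambda>_. b) \<inter> lat A (\<lambda>j. c j + e) = lat (basis (b - e)) f"
      using triple_in_basis[of b e] by blast
    obtain K where K: "\<And>j. j < d \<Longrightarrow> - f j \<le> K" using bounded_above_initial[of d "\<lambda>j. - f j"] by blast
    have "lat (basis (b - e)) f \<subseteq> lat (basis (b - e)) (\<lambda>_. - K)"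
      using K basis_props(1)[of "b - e"] by (intro lat_mono) force
    thus ?thesis using f by blast
  qed
  show "\<exists>a b e. lat M (\<lambda>_. 0) = triple a b e"
  proof -
    obtain f where f: "lat A (\<lambda>j. max 0 (c j)) = lat (basis 0) f" using basis_adapted by blast
    obtain K where K: "\<And>j. j < d \<Longrightarrow> f j \<le> K" using bounded_above_initial[of d f] by blast
    have "lat M (\<lambda>_. 0) \<subseteq> lat (basis 0) (\<lambda>j. f j + - K)"
      unfolding basis_props(3)[of 0] using K basis_props(1)[of 0] by (intro lat_mono) force
    also have "\<dots> = lat A (\<lambda>_. - K) \<inter> lat A (\<lambda>j. c j + - K)"
      unfolding Int_targets using lat_shift_cong[OF f, of "- K"] by simp
    finally have "lat M (\<lambda>_. 0) = triple 0 (- K) (- K)" unfolding triple_def by blast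
    thus ?thesis by blast
  qed
  show "\<exists>a b e. lat A (\<lambda>_. 0) = triple a b e"
  proof -
    obtain K where K: "\<And>j. j < d \<Longrightarrow> c j \<le> K" using bounded_above_initial[of d c] by blast
    have "lat A (\<lambda>_. 0) \<subseteq> lat A (\<lambda>j. c j + - K)"
      using K A_carrier by (intro lat_mono) force
    moreover obtain a where "lat A (\<lambda>_. 0) \<inter> lat A (\<lambda>j. c j + - K) \<subseteq> lat M (\<lambda>_. a)"
      using M_sub by blast
    ultimately have "lat A (\<lambda>_. 0) = triple a 0 (- K)" unfolding triple_def by blast
    thus ?thesis by blast
  qed
  show "\<exists>a b e. lat A c = triple a b e"
  proof -
    obtain K where K: "\<And>j. j < d \<Longrightarrow> - c j \<le> K" using bounded_above_initial[of d "\<lambda>j. - c j"] by blast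
    have "lat A c \<subseteq> lat A (\<lambda>_. - K)"
      using K A_carrier by (intro lat_mono) force
    moreover obtain a where "lat A (\<lambda>_. - K) \<inter> lat A (\<lambda>j. c j + 0) \<subseteq> lat M (\<lambda>_. a)"
      using M_sub by blast
    ultimately have "lat A c = triple a (- K) 0" unfolding triple_def by auto
    thus ?thesis by blast
  qed
qed

lemma lat_class_tripleI:
  "\<exists>a b e. \<Lambda> = triple a b e \<Longrightarrow> lat_class \<Lambda> \<in> {lat_class (triple a b e) | a b e. True}"
  unfolding mem_Collect_eq by metis

text \<open>Rescaling a triple shifts its three parameters and intersecting two takes their maxima,
  so representatives and finite intersections are triples again.\<close>

lemma convex_triples: "convex_classes val d {lat_class (triple a b e) | a b e. True}"
  unfolding convex_classes_def
proof (intro conjI allI impI)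
  show "{lat_class (triple a b e) | a b e. True} \<subseteq> building_vertices val d"
  proof -
    have "is_lattice val d (triple a b e)" for a b e
      using triple_eq_lat[of a b e] lat_is_lattice[OF basis_props(1,2)] by metis
    thus ?thesis unfolding building_vertices_def by blast
  qed
  fix F assume F: "finite F \<and> F \<noteq> {} \<and> F \<subseteq> \<Union>{lat_class (triple a b e) | a b e. True}"
  have triples: "\<exists>a b e. G = triple a b e" if "G \<in> F" for G
  proof -
    obtain a b e x where "x \<noteq> 0" "G = (\<lambda>v. x \<cdot>\<^sub>v v) ` triple a b e"
      using F \<open>G \<in> F\<close> unfolding lat_class_def by blast
    thus ?thesis using smult_triple by blast
  qed
  have "finite F" "F \<noteq> {}" using F by auto
  hence "\<exists>a b e. \<Inter>F = triple a b e" using triples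
  proof (induction F rule: finite_ne_induct)
    case (insert G F)
    obtain a b e where "\<Inter>F = triple a b e" using insert.IH insert.prems by blast
    moreover obtain a' b' e' where "G = triple a' b' e'" using insert.prems by blast
    ultimately have "\<Inter>(insert G F) = triple (max a' a) (max b' b) (max e' e)"
      using triple_Int by simp
    thus ?case by blast
  qed auto
  thus "lat_class (\<Inter>F) \<in> {lat_class (triple a b e) | a b e. True}"
    by (rule lat_class_tripleI)
qed

text \<open>The classes of triples form a convex set containing the three generators, so they
  contain the hull.\<close>

lemma conv_covered:
  assumes "x \<in> conv_lattices val d {lat M (\<lambda>_. 0), lat A (\<lambda>_. 0), lat A c}"
  shows "\<exists>m. x \<in> apt m"
proof -
  let ?S = "{lat_class (triple a b e) | a b e. True}"
  have "lat_class ` {lat M (\<lambda>_. 0), lat A (\<lambda>_. 0), lat A c} \<subseteq> ?S"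
    using lat_class_tripleI triple_generators by blast
  hence "conv_lattices val d {lat M (\<lambda>_. 0), lat A (\<lambda>_. 0), lat A c} \<subseteq> ?S"
    unfolding conv_lattices_def by (rule hull_minimal) (rule convex_triples)
  then obtain a b e where "x = lat_class (triple a b e)" using assms by blast
  thus ?thesis using lat_class_triple_in_apt by blast
qed

text \<open>If all exponents agreed, the two lattices would be multiples of each other. No loop body
  would then be executed and the list would be empty, so covering requires distinct classes.\<close>

lemma exponents_distinct:
  assumes "lat_class (lat A (\<lambda>_. 0)) \<noteq> lat_class (lat A c)"
  shows "c 0 < c (d - 1)"
proof (rule ccontr)
  assume "\<not> ?thesis"
  moreover have "c 0 \<le> c j" "c j \<le> c (d - 1)" if "j < d" for j
    using that by (auto intro: c_mono)
  ultimately have eq: "c j = 0 + c 0" if "j < d" for j using that by force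
  have "lat_class (lat A c) = lat_class (lat A (\<lambda>_. 0))"
    by (rule lat_class_lat_const, rule eq) (use A_carrier in simp)
  thus False using assms by simp
qed

end

theorem theorem5p2:
  fixes val :: "'a::field \<Rightarrow> int extended" and \<pi> :: 'a
    and d :: nat and M1 M2 M3 :: "'a mat"
  assumes "discrete_valuation val" and "uniformizer val \<pi>"
    and "M1 \<in> carrier_mat d d" and "invertible_mat M1"
    and "M2 \<in> carrier_mat d d" and "invertible_mat M2"
    and "M3 \<in> carrier_mat d d" and "invertible_mat M3"
  shows "(\<exists>A c. adapted_basis val \<pi> d M2 M3 A c) \<and>
    (\<forall>A c. adapted_basis val \<pi> d M2 M3 A c \<longrightarrow>
      (\<exists>L. convex_triangle val \<pi> d M1 A c = Some L \<and>
        L \<subseteq> apartments val \<pi> d \<and>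
        (lat_class (col_lattice val M2) \<noteq> lat_class (col_lattice val M3) \<longrightarrow>
          (\<forall>x \<in> conv_lattices val d {col_lattice val M1, col_lattice val M2, col_lattice val M3}.
             \<exists>a \<in> L. x \<in> a)) \<and>
        finite L \<and> card L \<le> 2 ^ d))"
proof -
  interpret V: uniformized_valuation val \<pi>
    using assms(1,2) unfolding uniformized_valuation_def uniformized_valuation_axioms_def uniformizer_def
    by simp
  show ?thesis
  proof (intro conjI allI impI)
    show "\<exists>A c. adapted_basis val \<pi> d M2 M3 A c"
      by (rule V.adapted_basis_exists[OF assms(5-8)])
    fix A c assume "adapted_basis val \<pi> d M2 M3 A c"
    hence A: "A \<in> carrier_mat d d" "invertible_mat A" "col_lattice val M2 = V.lat A (\<lambda>_. 0)"
      "col_lattice val M3 = V.lat A c" "\<And>i j. i \<le> j \<Longrightarrow> j < d \<Longrightarrow> c i \<le> c j"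
      using V.col_lattice_diag[of A d c] V.col_lattice_eq_lat[of A]
      unfolding adapted_basis_def by simp_all
    interpret T: convex_triangle_run val \<pi> d M1 A c
      by unfold_locales (use assms A in auto)
    \<comment> \<open>Termination and the size bound come from this inclusion in every case;
      equality with \<open>range T.apt\<close> is shown for distinct classes.\<close>
    obtain L where L: "convex_triangle val \<pi> d M1 A c = Some L" "L \<subseteq> range T.apt"
      using T.convex_triangle_covers_steps by blast
    have "\<exists>a\<in>L. x \<in> a"
      if "lat_class (col_lattice val M2) \<noteq> lat_class (col_lattice val M3)"
        "x \<in> conv_lattices val d {col_lattice val M1, col_lattice val M2, col_lattice val M3}" for x
    proof -
      have "L = range T.apt"
        using T.convex_triangle_covers_all T.exponents_distinct that(1) L(1) unfolding A by auto
      moreover have "\<exists>m. x \<in> T.apt m"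
        using that(2) unfolding A(3,4) V.col_lattice_eq_lat[of M1] by (rule T.conv_covered)
      ultimately show ?thesis by blast
    qed
    thus "\<exists>L. convex_triangle val \<pi> d M1 A c = Some L \<and>
        L \<subseteq> apartments val \<pi> d \<and>
        (lat_class (col_lattice val M2) \<noteq> lat_class (col_lattice val M3) \<longrightarrow>
          (\<forall>x \<in> conv_lattices val d {col_lattice val M1, col_lattice val M2, col_lattice val M3}.
             \<exists>a \<in> L. x \<in> a)) \<and>
        finite L \<and> card L \<le> 2 ^ d"
      using L T.range_apt_subset T.card_range_apt card_mono[OF T.card_range_apt(1) L(2)]
        finite_subset[OF L(2) T.card_range_apt(1)]
      by (intro exI[of _ L]) auto
  qed
qed

end
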